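(* Let $X_1,X_2$ be Polish spaces, $a_i:X_i\to[0,+\infty]$ Borel measurable ($i=1,2$), and $c:X_1\times X_2\to[0,+\infty]$ lower semicontinuous with $c(x_1,x_2)\le a_1(x_1)+a_2(x_2)$ for all $(x_1,x_2)$. Let $\phi_1:\mathcal P_{a_1}(X_1)\to[-\infty,+\infty)$ be $\mathsf C$-concave and not identically $-\infty$. Then: 1. It holds $$\partial^+_{\mathsf t,\mathsf C}\phi_1=\big\{\pi\in\mathcal P_{a_1\oplus a_2}(X_1\times X_2)\ :\ \pi\in\Gamma_{o,c}(\mathrm{pr}^1_\sharp\pi,\mathrm{pr}^2_\sharp\pi),\ (\mathrm{pr}^1_\sharp\pi,\mathrm{pr}^2_\sharp\pi)\in\partial^+_{\mathsf C}\phi_1\big\}.$$ In particular, all $\pi\in\partial^+_{\mathsf t,\mathsf C}\phi_1$ are $\mathsf C$-optimal (i.e. $\pi\in\Gamma_{o,c}(\mathrm{pr}^1_\sharp\pi,\mathrm{pr}^2_\sharp\pi)$) and $(\mathrm{pr}^1_\sharp,\mathrm{pr}^2_\sharp)\,\partial^+_{\mathsf t,\mathsf C}\phi_1=\partial^+_{\mathsf C}\phi_1$. 2. For $\pi\in\mathcal P_{a_1\oplus a_2}(X_1\times X_2)$, $\pi\in\partial^+_{\mathsf t,\mathsf C}\phi_1$ if and only if $$\phi_1(\mathrm{pr}^1_\sharp\pi)+\phi_1^{\mathsf C}(\mathrm{pr}^2_\sharp\pi)=\int_{X_1\times X_2}c(x_1,x_2)\,d\pi(x_1,x_2).$$ 3.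 $\partial^+_{\mathsf t,\mathsf C}\phi_1$ is totally $\mathsf C$-cyclically monotone.
   Context: $\mathcal P(Y)$ is the set of Borel probability measures on a Polish space $Y$; $\Gamma(\mu_1,\mu_2)$ is the set of couplings; $\mathrm{pr}^i$ are projections. $\mathsf C(\mu_1,\mu_2):=\min_{\pi\in\Gamma(\mu_1,\mu_2)}\int c\,d\pi$, and $\Gamma_{o,c}(\mu_1,\mu_2)$ is the set of minimizers. $\mathcal P_{a_i}(X_i):=\{\mu_i\in\mathcal P(X_i):\int a_i\,d\mu_i<+\infty\}$, $\mathcal P_{a_1\oplus a_2}(X_1\times X_2):=\{\pi\in\mathcal P(X_1\times X_2):\mathrm{pr}^i_\sharp\pi\in\mathcal P_{a_i}(X_i),\,i=1,2\}$. $\mathsf C$ is finite on $\mathcal P_{a_1}(X_1)\times\mathcal P_{a_2}(X_2)$ and the following notions refer to $\mathsf C$ restricted to this product. $\phi_1:\mathcal P_{a_1}(X_1)\to[-\infty,+\infty)$ is $\mathsf C$-concave if it is not identically $-\infty$ and there is $A\subset\mathcal P_{a_2}(X_2)\times\mathbb R$ with $\phi_1(\mu_1)=\inf_{(\mu_2,\alpha)\in A}\mathsf C(\mu_1,\mu_2)-\alpha$. Its $\mathsf C$-conjugate is $\phi_1^{\mathsf C}(\mu_2):=\inf_{\mu_1\in\mathcal P_{a_1}(X_1)}\mathsf C(\mu_1,\mu_2)-\phi_1(\mu_1)$. Its $\mathsf C$-superdifferential is $\partial^+_{\mathsf C}\phi_1:=\{(\mu_1,\mu_2)\in\mathcal P_{a_1}(X_1)\times\mathcal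 P_{a_2}(X_2):\phi_1(\mu_1)>-\infty,\ \mathsf C(\mu_1,\mu_2)-\phi_1(\mu_1)\le\mathsf C(\mu_1',\mu_2)-\phi_1(\mu_1')\ \forall\mu_1'\in\mathcal P_{a_1}(X_1)\}$. Total $\mathsf C$-superdifferential: $\partial^+_{\mathsf t,\mathsf C}\phi_1$ is the set of $\pi\in\mathcal P_{a_1\oplus a_2}(X_1\times X_2)$ such that for all $\theta\in\mathcal P(X_1\times X_2\times X_1)$ with $(\mathrm{pr}^1,\mathrm{pr}^2)_\sharp\theta=\pi$ and $\mathrm{pr}^3_\sharp\theta\in\mathcal P_{a_1}(X_1)$, $$\int\big(c(x_1,x_2)-c(x_1',x_2)\big)\,d\theta(x_1,x_2,x_1')\le\phi_1(\mathrm{pr}^1_\sharp\theta)-\phi_1(\mathrm{pr}^3_\sharp\theta).$$ Total $\mathsf C$-cyclical monotonicity: $F\subset\mathcal P_{a_1\oplus a_2}(X_1\times X_2)$ is totally $\mathsf C$-cyclically monotone if for all $N\ge1$, all $\theta\in\mathcal P((X_1\times X_2)^N)$ whose marginal $\mathrm{pr}^n_\sharp\theta$ on the $n$-th factor $X_1\times X_2$ belongs to $F$ for every $n\le N$, and all permutations $\sigma$ of $\{1,\dots,N\}$, $\int\sum_ic(x_{1,i},x_{2,i})\,d\theta\le\int\sum_ic(x_{1,i},x_{2,\sigma(i)})\,d\theta$. *)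

theory Defs
  imports "HOL-Probability.Probability"
begin

definition lower_semicont :: "('a::topological_space \<Rightarrow> ennreal) \<Rightarrow> bool" where
  "lower_semicont f \<longleftrightarrow> (\<forall>x. f x \<le> Liminf (nhds x) f)"

definition borel_probs :: "'a::topological_space measure set" where
  "borel_probs = {\<mu>. prob_space \<mu> \<and> sets \<mu> = sets borel}"

definition couplings ::
    "'a::topological_space measure \<Rightarrow> 'b::topological_space measure \<Rightarrow> ('a \<times> 'b) measure set" where
  "couplings \<mu>\<^sub>1 \<mu>\<^sub>2 =
     {\<pi> \<in> borel_probs. distr \<pi> borel fst = \<mu>\<^sub>1 \<and> distr \<pi> borel snd = \<mu>\<^sub>2}"

(* The minimum defining the optimal transport cost, taken as an infimum; the minimizers are
   singled out separately in opt_couplings. *)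
definition OT_cost ::
    "('a::topological_space \<times> 'b::topological_space \<Rightarrow> ennreal) \<Rightarrow> 'a measure \<Rightarrow> 'b measure \<Rightarrow> ennreal" where
  "OT_cost c \<mu>\<^sub>1 \<mu>\<^sub>2 = (INF \<pi>\<in>couplings \<mu>\<^sub>1 \<mu>\<^sub>2. \<integral>\<^sup>+x. c x \<partial>\<pi>)"

definition opt_couplings ::
    "('a::topological_space \<times> 'b::topological_space \<Rightarrow> ennreal) \<Rightarrow> 'a measure \<Rightarrow> 'b measure
      \<Rightarrow> ('a \<times> 'b) measure set" where
  "opt_couplings c \<mu>\<^sub>1 \<mu>\<^sub>2 =
     {\<pi> \<in> couplings \<mu>\<^sub>1 \<mu>\<^sub>2. \<forall>\<pi>'\<in>couplings \<mu>\<^sub>1 \<mu>\<^sub>2. (\<integral>\<^sup>+x. c x \<partial>\<pi>) \<le> (\<integral>\<^sup>+x. c x \<partial>\<pi>')}"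

definition probs_fin :: "('a::topological_space \<Rightarrow> ennreal) \<Rightarrow> 'a measure set" where
  "probs_fin a = {\<mu> \<in> borel_probs. (\<integral>\<^sup>+x. a x \<partial>\<mu>) < \<infinity>}"

definition plans_fin ::
    "('a::topological_space \<Rightarrow> ennreal) \<Rightarrow> ('b::topological_space \<Rightarrow> ennreal) \<Rightarrow> ('a \<times> 'b) measure set" where
  "plans_fin a\<^sub>1 a\<^sub>2 =
     {\<pi> \<in> borel_probs. distr \<pi> borel fst \<in> probs_fin a\<^sub>1 \<and> distr \<pi> borel snd \<in> probs_fin a\<^sub>2}"

(* A function on probs_fin a1 is a total function on measures, of which only the values on
   probs_fin a1 are ever used. *)

definition C_concave ::
    "('a::topological_space \<Rightarrow> ennreal) \<Rightarrow> ('b::topological_space \<Rightarrow> ennreal) \<Rightarrow> ('a \<times> 'b \<Rightarrow> ennreal)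
      \<Rightarrow> ('a measure \<Rightarrow> ereal) \<Rightarrow> bool" where
  "C_concave a\<^sub>1 a\<^sub>2 c \<phi> \<longleftrightarrow>
     (\<exists>\<mu>\<in>probs_fin a\<^sub>1. \<phi> \<mu> \<noteq> -\<infinity>) \<and>
     (\<exists>A \<subseteq> probs_fin a\<^sub>2 \<times> (UNIV :: real set).
        \<forall>\<mu>\<^sub>1\<in>probs_fin a\<^sub>1. \<phi> \<mu>\<^sub>1 = (INF (\<mu>\<^sub>2, \<alpha>)\<in>A. enn2ereal (OT_cost c \<mu>\<^sub>1 \<mu>\<^sub>2) - ereal \<alpha>))"

definition C_conj ::
    "('a::topological_space \<Rightarrow> ennreal) \<Rightarrow> ('a \<times> 'b::topological_space \<Rightarrow> ennreal)
      \<Rightarrow> ('a measure \<Rightarrow> ereal) \<Rightarrow> 'b measure \<Rightarrow> ereal" where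
  "C_conj a\<^sub>1 c \<phi> \<mu>\<^sub>2 = (INF \<mu>\<^sub>1\<in>probs_fin a\<^sub>1. enn2ereal (OT_cost c \<mu>\<^sub>1 \<mu>\<^sub>2) - \<phi> \<mu>\<^sub>1)"

definition C_superdiff ::
    "('a::topological_space \<Rightarrow> ennreal) \<Rightarrow> ('b::topological_space \<Rightarrow> ennreal) \<Rightarrow> ('a \<times> 'b \<Rightarrow> ennreal)
      \<Rightarrow> ('a measure \<Rightarrow> ereal) \<Rightarrow> ('a measure \<times> 'b measure) set" where
  "C_superdiff a\<^sub>1 a\<^sub>2 c \<phi> =
     {(\<mu>\<^sub>1, \<mu>\<^sub>2). \<mu>\<^sub>1 \<in> probs_fin a\<^sub>1 \<and> \<mu>\<^sub>2 \<in> probs_fin a\<^sub>2 \<and> \<phi> \<mu>\<^sub>1 > -\<infinity> \<and>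
        (\<forall>\<mu>\<^sub>1'\<in>probs_fin a\<^sub>1.
           enn2ereal (OT_cost c \<mu>\<^sub>1 \<mu>\<^sub>2) - \<phi> \<mu>\<^sub>1 \<le> enn2ereal (OT_cost c \<mu>\<^sub>1' \<mu>\<^sub>2) - \<phi> \<mu>\<^sub>1')}"

(* When c (x1, x2) \<le> a1 x1 + a2 x2, both cost terms are finite theta-almost everywhere and
   integrable, so passing to real values via enn2real changes the integrand only on a null set.
   The right-hand side -\<infinity> - (-\<infinity>), which is \<infinity> in ereal, does not affect the set: phi is
   finite at some mu, and a theta with third marginal mu excludes every pi whose first marginal
   has phi = -\<infinity>. *)
definition total_C_superdiff ::
    "('a::topological_space \<Rightarrow> ennreal) \<Rightarrow> ('b::topological_space \<Rightarrow> ennreal) \<Rightarrow> ('a \<times> 'b \<Rightarrow> ennreal)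
      \<Rightarrow> ('a measure \<Rightarrow> ereal) \<Rightarrow> ('a \<times> 'b) measure set" where
  "total_C_superdiff a\<^sub>1 a\<^sub>2 c \<phi> =
     {\<pi> \<in> plans_fin a\<^sub>1 a\<^sub>2. \<forall>\<theta> \<in> (borel_probs :: ('a \<times> 'b \<times> 'a) measure set).
        distr \<theta> borel (\<lambda>(x\<^sub>1, x\<^sub>2, x\<^sub>1'). (x\<^sub>1, x\<^sub>2)) = \<pi> \<longrightarrow>
        distr \<theta> borel (\<lambda>(x\<^sub>1, x\<^sub>2, x\<^sub>1'). x\<^sub>1') \<in> probs_fin a\<^sub>1 \<longrightarrow>
        ereal (\<integral>(x\<^sub>1, x\<^sub>2, x\<^sub>1'). enn2real (c (x\<^sub>1, x\<^sub>2)) - enn2real (c (x\<^sub>1', x\<^sub>2)) \<partial>\<theta>)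
          \<le> \<phi> (distr \<theta> borel (\<lambda>(x\<^sub>1, x\<^sub>2, x\<^sub>1'). x\<^sub>1)) - \<phi> (distr \<theta> borel (\<lambda>(x\<^sub>1, x\<^sub>2, x\<^sub>1'). x\<^sub>1'))}"

(* The N-fold product is the space of extensional functions on {1..N} with the product
   sigma-algebra, which is the Borel one because the factors are second countable. *)
definition totally_C_cyclically_monotone ::
    "('a::topological_space \<times> 'b::topological_space \<Rightarrow> ennreal) \<Rightarrow> ('a \<times> 'b) measure set \<Rightarrow> bool" where
  "totally_C_cyclically_monotone c F \<longleftrightarrow>
     (\<forall>N\<ge>1. \<forall>\<theta> :: (nat \<Rightarrow> 'a \<times> 'b) measure. \<forall>\<sigma>.
        prob_space \<theta> \<longrightarrow> sets \<theta> = sets (\<Pi>\<^sub>M n\<in>{1..N}. borel) \<longrightarrow>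
        (\<forall>n\<in>{1..N}. distr \<theta> borel (\<lambda>x. x n) \<in> F) \<longrightarrow> \<sigma> permutes {1..N} \<longrightarrow>
        (\<integral>\<^sup>+x. (\<Sum>i=1..N. c (fst (x i), snd (x i))) \<partial>\<theta>)
          \<le> (\<integral>\<^sup>+x. (\<Sum>i=1..N. c (fst (x i), snd (x (\<sigma> i)))) \<partial>\<theta>))"

end

theory Submission
  imports Defs
begin

text \<open>Testing the total superdifferential on \<open>\<theta>\<close> only involves the plan \<open>\<pi>'\<close> of the third and second
  coordinates. By gluing, every plan \<open>\<pi>'\<close> with the same second marginal as \<open>\<pi>\<close> arises in this way, so
  membership means \<open>\<integral>c d\<pi> - \<integral>c d\<pi>' \<le> \<phi> \<mu>\<^sub>1 - \<phi> \<mu>\<^sub>1'\<close> for all such \<open>\<pi>'\<close>. Minimising over \<open>\<pi>'\<close>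
  turns this into equality in Fenchel's inequality \<open>\<phi> \<mu>\<^sub>1 + \<phi>\<^sup>C \<mu>\<^sub>2 \<le> C(\<mu>\<^sub>1, \<mu>\<^sub>2) \<le> \<integral>c d\<pi>\<close>, and total
  cyclical monotonicity follows by summing that inequality along the permutation.

  Existence of optimal plans and the gluing property both rest on compactness of the set of
  couplings of two measures on Polish spaces. Along a filter finer than \<open>sequentially\<close> (Tychonoff), a sequence of
  couplings converges setwise to a finitely additive set function; its marginals are inner regular,
  so Caratheodory's theorem yields a limiting coupling. Gluing is the limit of couplings of \<open>\<pi>\<close> and
  \<open>\<pi>'\<close> that are independent given the cell of the shared coordinate in ever finer finite partitions.\<close>

subsection \<open>Compactness of couplings\<close>

lemma pointwise_limit_filter:
  fixes f :: "nat \<Rightarrow> 'i \<Rightarrow> real"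
  assumes "\<And>n i. f n i \<in> {a..b}"
  obtains G m where "G \<noteq> bot" "G \<le> sequentially" "\<And>i. ((\<lambda>n. f n i) \<longlongrightarrow> m i) G"
proof -
  have "compact (PiE UNIV (\<lambda>_::'i. {a..b}))"
    by (simp flip: compactin_euclidean_iff euclidean_product_topology add: compactin_PiE)
       (simp add: compactin_euclidean_iff)
  moreover have "filtermap f sequentially \<noteq> bot"
    by (simp add: filtermap_bot_iff)
  moreover have "eventually (\<lambda>g. g \<in> PiE UNIV (\<lambda>_. {a..b})) (filtermap f sequentially)"
    using assms by (simp add: eventually_filtermap PiE_def)
  ultimately obtain m where m: "inf (nhds m) (filtermap f sequentially) \<noteq> bot"
    unfolding compact_filter by blast
  define G where "G = inf (filtercomap f (nhds m)) sequentially"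
  have "G \<noteq> bot"
  proof
    assume "G = bot"
    then have "eventually (\<lambda>_. False) G" by simp
    then obtain P Q where P: "eventually P (nhds m)" and Q: "eventually Q sequentially"
      and PQ: "\<And>n. P (f n) \<Longrightarrow> Q n \<Longrightarrow> False"
      unfolding G_def eventually_inf eventually_filtercomap by blast
    from Q have "eventually (\<lambda>g. \<not> P g) (filtermap f sequentially)"
      unfolding eventually_filtermap by (rule eventually_mono) (use PQ in blast)
    with P have "eventually (\<lambda>_. False) (inf (nhds m) (filtermap f sequentially))"
      unfolding eventually_inf by blast
    with m show False by (simp add: eventually_False)
  qed
  moreover have "((\<lambda>n. f n i) \<longlongrightarrow> m i) G" for i
  proof -
    have f: "(f \<longlongrightarrow> m) G"
      unfolding G_def by (rule filterlim_mono[OF filterlim_filtercomap order_refl]) simp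
    have "continuous_on UNIV (\<lambda>g::'i \<Rightarrow> real. g i)" by simp
    from continuous_on_tendsto_compose[OF this f] show ?thesis by simp
  qed
  ultimately show ?thesis
    using that[of G m] by (simp add: G_def)
qed

locale finitely_additive =
  fixes m :: "'a::t2_space set \<Rightarrow> real"
  assumes nonneg: "A \<in> sets borel \<Longrightarrow> 0 \<le> m A"
    and add: "A \<in> sets borel \<Longrightarrow> B \<in> sets borel \<Longrightarrow> A \<inter> B = {} \<Longrightarrow> m (A \<union> B) = m A + m B"
begin

lemma empty: "m {} = 0"
  using add[of "{}" "{}"] by simp

lemma mono:
  assumes "A \<subseteq> B" "A \<in> sets borel" "B \<in> sets borel"
  shows "m A \<le> m B"
proof -
  have "m B = m A + m (B - A)"
    using add[of A "B - A"] assms by (simp add: Un_absorb1)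
  with nonneg[of "B - A"] assms show ?thesis by simp
qed

lemma subadd:
  assumes "A \<in> sets borel" "B \<in> sets borel"
  shows "m (A \<union> B) \<le> m A + m B"
proof -
  have "m (A \<union> B) = m A + m (B - A)" using add[of A "B - A"] assms by simp
  also have "m (B - A) \<le> m B" by (rule mono) (use assms in auto)
  finally show ?thesis by simp
qed

definition inner_compact :: "'a set \<Rightarrow> bool" where
  "inner_compact A \<longleftrightarrow> A \<in> sets borel \<and> (\<forall>e>0. \<exists>K. compact K \<and> K \<subseteq> A \<and> m (A - K) \<le> e)"

lemma inner_compact_binop:
  assumes A: "inner_compact A" and B: "inner_compact B"
    and f: "\<And>A B. A \<in> sets borel \<Longrightarrow> B \<in> sets borel \<Longrightarrow> f A B \<in> sets borel"
    and compact: "\<And>K L. compact K \<Longrightarrow> compact L \<Longrightarrow> compact (f K L)"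
    and sub: "\<And>K L. K \<subseteq> A \<Longrightarrow> L \<subseteq> B \<Longrightarrow> f K L \<subseteq> f A B \<and> f A B - f K L \<subseteq> (A - K) \<union> (B - L)"
  shows "inner_compact (f A B)"
  unfolding inner_compact_def
proof (intro conjI allI impI)
  have Ab: "A \<in> sets borel" and Bb: "B \<in> sets borel"
    using A B by (auto simp: inner_compact_def)
  then show "f A B \<in> sets borel" by (rule f)
  fix e :: real assume "0 < e"
  then obtain K L where K: "compact K" "K \<subseteq> A" "m (A - K) \<le> e/2"
    and L: "compact L" "L \<subseteq> B" "m (B - L) \<le> e/2"
    using A B unfolding inner_compact_def by (meson half_gt_zero)
  have b: "K \<in> sets borel" "L \<in> sets borel"
    using K(1) L(1) by (simp_all add: borel_compact)
  have "m (f A B - f K L) \<le> m ((A - K) \<union> (B - L))"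
    by (rule mono) (use sub K(2) L(2) f b Ab Bb in auto)
  also have "\<dots> \<le> m (A - K) + m (B - L)"
    by (rule subadd) (use Ab Bb b in auto)
  finally show "\<exists>K. compact K \<and> K \<subseteq> f A B \<and> m (f A B - K) \<le> e"
    using K L compact[of K L] sub[of K L] by (intro exI[of _ "f K L"]) auto
qed

lemma inner_compact_Un: "inner_compact A \<Longrightarrow> inner_compact B \<Longrightarrow> inner_compact (A \<union> B)"
  by (rule inner_compact_binop) auto

lemma inner_compact_Int: "inner_compact A \<Longrightarrow> inner_compact B \<Longrightarrow> inner_compact (A \<inter> B)"
  by (rule inner_compact_binop) (auto intro: compact_Int)

text \<open>On this algebra compactness upgrades finite to countable additivity; the extension agrees with
  \<open>m\<close> only here, not on all Borel sets.\<close>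

definition compact_algebra :: "'a set set" where
  "compact_algebra = {A. inner_compact A \<and> inner_compact (- A)}"

lemma compact_algebra_borel: "compact_algebra \<subseteq> sets borel"
  by (auto simp: compact_algebra_def inner_compact_def)

lemma algebra_compact_algebra:
  assumes "inner_compact UNIV"
  shows "algebra UNIV compact_algebra"
proof -
  have "inner_compact {}"
    unfolding inner_compact_def by (auto simp: empty intro!: exI[of _ "{}"])
  with assms show ?thesis
    unfolding algebra_iff_Un compact_algebra_def
    by (auto simp flip: Compl_eq_Diff_UNIV intro: inner_compact_Un inner_compact_Int)
qed

lemma extends_from_compact_algebra:
  assumes "inner_compact UNIV"
  obtains P where "space P = UNIV" "sets P = sigma_sets UNIV compact_algebra"
    "\<And>A. A \<in> compact_algebra \<Longrightarrow> emeasure P A = ennreal (m A)"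
proof -
  interpret algebra UNIV compact_algebra
    by (rule algebra_compact_algebra) fact
  have tight: "\<exists>K. compact K \<and> K \<subseteq> A \<and> m (A - K) \<le> e" if "A \<in> compact_algebra" "0 < e" for A e
    using that by (auto simp: compact_algebra_def inner_compact_def)
  have "\<exists>\<mu>. (\<forall>s\<in>compact_algebra. \<mu> s = ennreal (m s)) \<and> measure_space UNIV (sigma_sets UNIV compact_algebra) \<mu>"
  proof (rule caratheodory_empty_continuous)
    show "positive compact_algebra (\<lambda>s. ennreal (m s))" by (simp add: positive_def empty)
    show "additive compact_algebra (\<lambda>s. ennreal (m s))"
      using compact_algebra_borel by (auto simp: additive_def add nonneg subset_iff ennreal_plus)
  next
    fix E :: "nat \<Rightarrow> 'a set" assume E: "range E \<subseteq> compact_algebra" "decseq E" "(\<Inter>i. E i) = {}"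
    then have Eb: "E i \<in> sets borel" for i using compact_algebra_borel by blast
    have "(\<lambda>i. m (E i)) \<longlonglongrightarrow> 0"
    proof (rule LIMSEQ_I)
      fix r :: real assume "0 < r"
      define e where "e i = (r / 4) * (1/2)^i" for i :: nat
      have "\<exists>K. compact K \<and> K \<subseteq> E i \<and> m (E i - K) \<le> e i" for i
        by (rule tight) (use E \<open>0 < r\<close> in \<open>auto simp: e_def\<close>)
      then obtain K where K: "\<And>i. compact (K i)" "\<And>i. K i \<subseteq> E i" "\<And>i. m (E i - K i) \<le> e i"
        by metis
      have Kb: "K i \<in> sets borel" for i using K(1) by (simp add: borel_compact)
      have "\<exists>n. (\<Inter>i\<le>n. K i) = {}"
      proof (rule ccontr)
        assume ne: "\<nexists>n. (\<Inter>i\<le>n. K i) = {}"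
        have "K 0 \<inter> \<Inter>(range K) \<noteq> {}"
        proof (rule compact_imp_fip[OF K(1)])
          fix F assume F: "finite F" "F \<subseteq> range K"
          then obtain I where I: "finite I" "F = K ` I" by (meson finite_subset_image)
          have "(\<Inter>i\<le>Max (insert 0 I). K i) \<subseteq> K 0 \<inter> \<Inter>F"
            using I by (auto simp: I(2))
          then show "K 0 \<inter> \<Inter>F \<noteq> {}" using ne by blast
        qed (use K(1) compact_imp_closed in blast)
        moreover have "\<Inter>(range K) \<subseteq> (\<Inter>i. E i)" by (rule INF_mono') (use K(2) in auto)
        ultimately show False by (simp add: E(3))
      qed
      then obtain n where n: "(\<Inter>i\<le>n. K i) = {}" by blast
      have bound: "m (\<Union>i\<le>l. E k - K i) \<le> (\<Sum>i\<le>l. e i)" if "l \<le> k" for k l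
        using that
      proof (induction l)
        case 0
        then have "m (E k - K 0) \<le> m (E 0 - K 0)"
          by (intro mono) (use Eb Kb decseqD[OF E(2), of 0 k] in auto)
        then show ?case using K(3)[of 0] by simp
      next
        case (Suc l)
        have "m (E k - K (Suc l)) \<le> m (E (Suc l) - K (Suc l))"
          by (intro mono) (use Eb Kb decseqD[OF E(2), of "Suc l" k] Suc in auto)
        moreover have "m ((\<Union>i\<le>l. E k - K i) \<union> (E k - K (Suc l))) \<le> m (\<Union>i\<le>l. E k - K i) + m (E k - K (Suc l))"
          by (rule subadd) (use Eb Kb in auto)
        ultimately show ?case using Suc K(3)[of "Suc l"]
          by (simp add: atMost_Suc Un_commute)
      qed
      have "(\<Sum>i\<le>k. e i) \<le> r / 2" for k
      proof -
        have "(\<Sum>i\<le>k. e i) = (r/4) * (\<Sum>i\<le>k. (1/2)^i)" by (simp add: e_def sum_distrib_left)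
        also have "(\<Sum>i\<le>k. (1/2)^i) \<le> (2::real)"
          by (simp add: sum_gp0)
        finally show ?thesis using \<open>0 < r\<close> by simp
      qed
      moreover have "E k = (\<Union>i\<le>k. E k - K i)" if "n \<le> k" for k
      proof -
        have "(\<Inter>i\<le>k. K i) \<subseteq> (\<Inter>i\<le>n. K i)" using that by auto
        with n have "(\<Inter>i\<le>k. K i) = {}" by (metis subset_empty)
        then show ?thesis by auto
      qed
      ultimately have "m (E k) \<le> r / 2" if "n \<le> k" for k
        using bound[of k k] that by (metis order_refl order_trans)
      then show "\<exists>no. \<forall>k\<ge>no. norm (m (E k) - 0) < r"
        using \<open>0 < r\<close> nonneg[OF Eb] by (intro exI[of _ n]) (fastforce simp: abs_of_nonneg)
    qed
    then show "(\<lambda>i. ennreal (m (E i))) \<longlonglongrightarrow> 0"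
      using tendsto_ennrealI by fastforce
  qed simp
  then obtain \<mu> where \<mu>: "\<And>s. s \<in> compact_algebra \<Longrightarrow> \<mu> s = ennreal (m s)" "measure_space UNIV (sigma_sets UNIV compact_algebra) \<mu>"
    by blast
  let ?P = "measure_of UNIV compact_algebra \<mu>"
  have sets: "sets ?P = sigma_sets UNIV compact_algebra" by simp
  have "emeasure ?P A = ennreal (m A)" if "A \<in> compact_algebra" for A
  proof -
    have "emeasure ?P A = \<mu> A"
      using that \<mu>(2) by (intro emeasure_measure_of) (auto simp: measure_space_def)
    then show ?thesis using \<mu>(1) that by simp
  qed
  then show ?thesis using that[of ?P] sets by simp
qed

end

lemma couplingsD:
  assumes "\<pi> \<in> couplings \<mu> \<nu>"
  shows "prob_space \<pi>" "sets \<pi> = sets borel" "space \<pi> = UNIV" "distr \<pi> borel fst = \<mu>" "distr \<pi> borel snd = \<nu>"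
  using assms sets_eq_imp_space_eq[of \<pi> borel] by (auto simp: couplings_def borel_probs_def)

lemma couplings_fst_vimage:
  fixes \<mu> :: "'a::second_countable_topology measure" and \<nu> :: "'b::second_countable_topology measure"
  assumes "\<pi> \<in> couplings \<mu> \<nu>" "A \<in> sets borel"
  shows "emeasure \<pi> (A \<times> UNIV) = emeasure \<mu> A"
proof -
  have "fst \<in> \<pi> \<rightarrow>\<^sub>M borel"
    using couplingsD[OF assms(1)] by (simp cong: measurable_cong_sets flip: borel_prod)
  then have "emeasure (distr \<pi> borel fst) A = emeasure \<pi> (fst -` A \<inter> space \<pi>)"
    using assms(2) by (rule emeasure_distr)
  then show ?thesis
    using couplingsD[OF assms(1)] by (simp add: fst_vimage_eq_Times)
qed

lemma couplings_snd_vimage: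
  fixes \<mu> :: "'a::second_countable_topology measure" and \<nu> :: "'b::second_countable_topology measure"
  assumes "\<pi> \<in> couplings \<mu> \<nu>" "B \<in> sets borel"
  shows "emeasure \<pi> (UNIV \<times> B) = emeasure \<nu> B"
proof -
  have "snd \<in> \<pi> \<rightarrow>\<^sub>M borel"
    using couplingsD[OF assms(1)] by (simp cong: measurable_cong_sets flip: borel_prod)
  then have "emeasure (distr \<pi> borel snd) B = emeasure \<pi> (snd -` B \<inter> space \<pi>)"
    using assms(2) by (rule emeasure_distr)
  then show ?thesis
    using couplingsD[OF assms(1)] by (simp add: snd_vimage_eq_Times)
qed

lemma couplings_marginals:
  fixes \<mu> :: "'a::second_countable_topology measure" and \<nu> :: "'b::second_countable_topology measure"
  assumes "\<pi> \<in> couplings \<mu> \<nu>"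
  shows "\<mu> \<in> borel_probs" "\<nu> \<in> borel_probs"
proof -
  interpret prob_space \<pi> by (rule couplingsD[OF assms])
  have "fst \<in> \<pi> \<rightarrow>\<^sub>M borel" "snd \<in> \<pi> \<rightarrow>\<^sub>M borel"
    using couplingsD[OF assms] by (simp_all cong: measurable_cong_sets flip: borel_prod)
  then have "prob_space (distr \<pi> borel fst)" "prob_space (distr \<pi> borel snd)"
    by (simp_all add: prob_space_distr)
  then show "\<mu> \<in> borel_probs" "\<nu> \<in> borel_probs"
    using couplingsD[OF assms] by (auto simp: borel_probs_def)
qed

lemma borel_probs_inner_compact:
  fixes \<mu> :: "'a::{second_countable_topology, complete_space} measure"
  assumes "\<mu> \<in> borel_probs" "A \<in> sets borel" "0 < e"
  shows "\<exists>K. compact K \<and> K \<subseteq> A \<and> measure \<mu> (A - K) \<le> e"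
proof -
  interpret prob_space \<mu> using assms by (simp add: borel_probs_def)
  have sets: "sets \<mu> = sets borel" using assms by (simp add: borel_probs_def)
  show ?thesis
  proof (cases "measure \<mu> A \<le> e")
    case True
    then show ?thesis by (intro exI[of _ "{}"]) simp
  next
    case False
    have "ennreal (measure \<mu> A - e) < emeasure \<mu> A"
      using False \<open>0 < e\<close> by (simp add: emeasure_eq_measure ennreal_less_iff)
    also have "emeasure \<mu> A = (SUP K \<in> {K. K \<subseteq> A \<and> compact K}. emeasure \<mu> K)"
      by (rule inner_regular) (use sets assms in \<open>auto simp: emeasure_eq_measure\<close>)
    finally obtain K where K: "K \<subseteq> A" "compact K" "ennreal (measure \<mu> A - e) < emeasure \<mu> K"
      unfolding less_SUP_iff by blast
    have "measure \<mu> A - e \<le> measure \<mu> K"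
      using K(3) False by (simp add: emeasure_eq_measure ennreal_less_iff)
    moreover have "measure \<mu> (A - K) = measure \<mu> A - measure \<mu> K"
      by (rule finite_measure_Diff) (use K sets assms in \<open>auto simp: borel_compact\<close>)
    ultimately show ?thesis using K by (intro exI[of _ K]) auto
  qed
qed

text \<open>Strong enough for lower semicontinuous integrands and for events in the product algebra, which is
  all that is needed in place of weak convergence.\<close>

definition rectangle_limit ::
    "'i filter \<Rightarrow> ('i \<Rightarrow> ('a::topological_space \<times> 'b::topological_space) measure) \<Rightarrow> ('a \<times> 'b) measure \<Rightarrow> bool" where
  "rectangle_limit G \<pi> P \<longleftrightarrow>
     (\<exists>\<M>. algebra UNIV \<M> \<and> \<M> \<subseteq> sets borel \<and>
        (\<forall>A\<in>sets borel. \<forall>B\<in>sets borel. A \<times> B \<in> \<M>) \<and>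
        (\<forall>E\<in>\<M>. ((\<lambda>n. measure (\<pi> n) E) \<longlongrightarrow> measure P E) G))"

proposition couplings_limit:
  fixes \<mu> :: "'a::{second_countable_topology, complete_space} measure"
    and \<nu> :: "'b::{second_countable_topology, complete_space} measure"
  assumes \<pi>: "\<And>n::nat. \<pi> n \<in> couplings \<mu> \<nu>"
  obtains P G where "P \<in> couplings \<mu> \<nu>" "G \<noteq> bot" "G \<le> sequentially" "rectangle_limit G \<pi> P"
proof -
  note prob = couplingsD(1)[OF \<pi>] and sets = couplingsD(2)[OF \<pi>]
  have \<mu>: "\<mu> \<in> borel_probs" and \<nu>: "\<nu> \<in> borel_probs"
    using couplings_marginals[OF \<pi>] by auto
  have times: "A \<times> B \<in> sets borel" if "A \<in> sets borel" "B \<in> sets borel" for A :: "'a set" and B :: "'b set"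
    using that by (simp flip: borel_prod)
  have "measure (\<pi> n) E \<in> {0..1}" for n E
    using prob_space.prob_le_1[OF prob] by auto
  from pointwise_limit_filter[of "\<lambda>n. measure (\<pi> n)", OF this]
  obtain G m where G: "G \<noteq> bot" "G \<le> sequentially" and m: "\<And>E. ((\<lambda>n. measure (\<pi> n) E) \<longlongrightarrow> m E) G"
    by blast
  have m_const: "m E = r" if "\<And>n. measure (\<pi> n) E = r" for E r
    using tendsto_unique[OF G(1) m[of E]] that by auto
  interpret finitely_additive m
  proof
    show "0 \<le> m A" for A
      by (rule tendsto_lowerbound[OF m]) (auto simp: G)
    fix A B :: "('a \<times> 'b) set" assume "A \<in> sets borel" "B \<in> sets borel" "A \<inter> B = {}"
    then have "(\<lambda>n. measure (\<pi> n) (A \<union> B)) = (\<lambda>n. measure (\<pi> n) A + measure (\<pi> n) B)"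
      by (auto simp: sets finite_measure.finite_measure_Union[OF prob_space.finite_measure[OF prob]])
    then show "m (A \<union> B) = m A + m B"
      using tendsto_unique[OF G(1) m[of "A \<union> B"]] tendsto_add[OF m m] by auto
  qed
  have m_fst: "m (A \<times> UNIV) = measure \<mu> A" if "A \<in> sets borel" for A
    by (rule m_const) (simp add: measure_def couplings_fst_vimage[OF \<pi> that])
  have m_snd: "m (UNIV \<times> B) = measure \<nu> B" if "B \<in> sets borel" for B
    by (rule m_const) (simp add: measure_def couplings_snd_vimage[OF \<pi> that])
  have inner_rect: "inner_compact (A \<times> B)" if A: "A \<in> sets borel" and B: "B \<in> sets borel" for A B
    unfolding inner_compact_def
  proof (intro conjI allI impI)
    show "A \<times> B \<in> sets borel" using A B by (rule times)
    fix e :: real assume "0 < e"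
    obtain K where K: "compact K" "K \<subseteq> A" "measure \<mu> (A - K) \<le> e/2"
      using borel_probs_inner_compact[OF \<mu> A, of "e/2"] \<open>0 < e\<close> by auto
    obtain L where L: "compact L" "L \<subseteq> B" "measure \<nu> (B - L) \<le> e/2"
      using borel_probs_inner_compact[OF \<nu> B, of "e/2"] \<open>0 < e\<close> by auto
    have KL: "A - K \<in> sets borel" "B - L \<in> sets borel" "K \<times> L \<in> sets borel"
      using A B K L by (auto simp: borel_compact times)
    have "m (A \<times> B - K \<times> L) \<le> m ((A - K) \<times> UNIV \<union> UNIV \<times> (B - L))"
      by (rule mono) (use KL times[OF A B] in \<open>auto simp: times\<close>)
    also have "\<dots> \<le> m ((A - K) \<times> UNIV) + m (UNIV \<times> (B - L))"
      by (rule subadd) (use KL in \<open>auto simp: times\<close>)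
    also have "\<dots> \<le> e" using K(3) L(3) KL by (simp add: m_fst m_snd)
    finally show "\<exists>C. compact C \<and> C \<subseteq> A \<times> B \<and> m (A \<times> B - C) \<le> e"
      using K L by (intro exI[of _ "K \<times> L"]) (auto intro: compact_Times)
  qed
  have rect: "A \<times> B \<in> compact_algebra" if A: "A \<in> sets borel" and B: "B \<in> sets borel" for A B
  proof -
    have "- (A \<times> B) = (- A) \<times> UNIV \<union> UNIV \<times> (- B)" by auto
    then show ?thesis
      using A B by (auto simp: compact_algebra_def intro!: inner_rect inner_compact_Un)
  qed
  have UNIV: "inner_compact UNIV"
    using inner_rect[of UNIV UNIV] by simp
  obtain P where P: "space P = UNIV" "sets P = sigma_sets UNIV compact_algebra"
    "\<And>A. A \<in> compact_algebra \<Longrightarrow> emeasure P A = ennreal (m A)"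
    using extends_from_compact_algebra[OF UNIV] by blast
  have setsP: "sets P = sets borel"
  proof
    show "sets P \<subseteq> sets borel"
      unfolding P(2) by (rule borel_sigma_sets_subset[OF compact_algebra_borel])
    have "sets (borel :: ('a \<times> 'b) measure) =
        sigma_sets UNIV {A \<times> B | A B. A \<in> sets borel \<and> B \<in> sets borel}"
      by (simp add: sets_pair_measure flip: borel_prod)
    also have "\<dots> \<subseteq> sets P"
      unfolding P(2) by (rule sigma_sets_mono') (auto intro: rect)
    finally show "sets borel \<subseteq> sets P" .
  qed
  have fst: "emeasure P (A \<times> UNIV) = emeasure \<mu> A" if "A \<in> sets borel" for A
    using that \<mu> rect[of A UNIV]
    by (simp add: P(3) m_fst borel_probs_def finite_measure.emeasure_eq_measure prob_space.finite_measure)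
  have snd: "emeasure P (UNIV \<times> B) = emeasure \<nu> B" if "B \<in> sets borel" for B
    using that \<nu> rect[of UNIV B]
    by (simp add: P(3) m_snd borel_probs_def finite_measure.emeasure_eq_measure prob_space.finite_measure)
  have "emeasure P UNIV = 1"
    using fst[of UNIV] \<mu> prob_space.emeasure_space_1[of \<mu>] sets_eq_imp_space_eq[of \<mu> borel]
    by (simp add: borel_probs_def)
  then have probP: "prob_space P" by (intro prob_spaceI) (simp add: P)
  have "P \<in> couplings \<mu> \<nu>"
    unfolding couplings_def
  proof (intro CollectI conjI)
    show "P \<in> borel_probs" using probP setsP by (simp add: borel_probs_def)
    have fs: "fst \<in> P \<rightarrow>\<^sub>M borel" "snd \<in> P \<rightarrow>\<^sub>M borel"
      using setsP by (simp_all cong: measurable_cong_sets flip: borel_prod)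
    show "distr P borel fst = \<mu>"
      using \<mu> fs(1) fst by (intro measure_eqI) (auto simp: borel_probs_def emeasure_distr P(1) fst_vimage_eq_Times)
    show "distr P borel snd = \<nu>"
      using \<nu> fs(2) snd by (intro measure_eqI) (auto simp: borel_probs_def emeasure_distr P(1) snd_vimage_eq_Times)
  qed
  moreover have "measure P E = m E" if "E \<in> compact_algebra" for E
    using P(3)[OF that] nonneg compact_algebra_borel that by (auto simp: measure_def)
  then have "rectangle_limit G \<pi> P"
    unfolding rectangle_limit_def
    using m algebra_compact_algebra[OF UNIV] compact_algebra_borel rect
    by (intro exI[of _ compact_algebra]) auto
  ultimately show ?thesis using that[of P G] G by blast
qed

subsection \<open>Lower semicontinuous costs and optimal couplings\<close>

lemma lower_semicont_open: "lower_semicont f \<Longrightarrow> open {x. y < f x}"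
  unfolding lower_semicont_def le_Liminf_iff open_subopen[of "{x. y < f x}"]
  by (auto simp: eventually_nhds subset_eq)

lemma lower_semicont_measurable: "lower_semicont f \<Longrightarrow> f \<in> borel_measurable borel"
  by (rule borel_measurableI_greater) (simp add: lower_semicont_open borel_open)

definition algebra_simple :: "'a set set \<Rightarrow> ('a \<Rightarrow> ennreal) \<Rightarrow> bool" where
  "algebra_simple \<M> f \<longleftrightarrow> finite (range f) \<and> (\<forall>S. f -` S \<in> \<M>)"

lemma algebra_simple_sup:
  assumes "algebra UNIV \<M>" "algebra_simple \<M> f" "algebra_simple \<M> g"
  shows "algebra_simple \<M> (\<lambda>x. sup (f x) (g x))"
  unfolding algebra_simple_def
proof (intro conjI allI)
  interpret algebra UNIV \<M> by fact
  have fin: "finite (range f)" "finite (range g)"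
    using assms by (auto simp: algebra_simple_def)
  have "range (\<lambda>x. sup (f x) (g x)) \<subseteq> (\<lambda>(a, b). sup a b) ` (range f \<times> range g)" by auto
  then show "finite (range (\<lambda>x. sup (f x) (g x)))"
    by (rule finite_subset) (use fin in auto)
  fix S
  have "(\<lambda>x. sup (f x) (g x)) -` S =
    (\<Union>(a, b)\<in>{p \<in> range f \<times> range g. sup (fst p) (snd p) \<in> S}. f -` {a} \<inter> g -` {b})"
    by (auto, blast)
  also have "\<dots> \<in> \<M>"
    by (rule finite_UN) (use fin assms in \<open>auto simp: algebra_simple_def\<close>)
  finally show "(\<lambda>x. sup (f x) (g x)) -` S \<in> \<M>" .
qed

lemma algebra_simple_indicator:
  assumes "algebra UNIV \<M>" "R \<in> \<M>"
  shows "algebra_simple \<M> (\<lambda>x. r * indicator R x)"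
  unfolding algebra_simple_def
proof (intro conjI allI)
  interpret algebra UNIV \<M> by fact
  have "range (\<lambda>x. r * indicator R x) \<subseteq> {0, r}"
    by (auto simp: indicator_def)
  then show "finite (range (\<lambda>x. r * indicator R x))"
    by (rule finite_subset) simp
  fix S
  have "(\<lambda>x. r * indicator R x) -` S = (if r \<in> S then R else {}) \<union> (if 0 \<in> S then UNIV - R else {})"
    by (intro set_eqI) (simp add: indicator_def)
  also have "\<dots> \<in> \<M>" using assms top by (auto intro!: Un)
  finally show "(\<lambda>x. r * indicator R x) -` S \<in> \<M>" .
qed

lemma nn_integral_algebra_simple:
  assumes "algebra_simple \<M> f" "\<M> \<subseteq> sets borel" "sets P = sets borel" "prob_space P"
  shows "(\<integral>\<^sup>+x. f x \<partial>P) = (\<Sum>v\<in>range f. v * ennreal (measure P (f -` {v})))"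
proof -
  interpret prob_space P by fact
  have UNIV: "space P = UNIV" using sets_eq_imp_space_eq[OF assms(3)] by simp
  have "simple_function P f"
    using assms by (auto simp: simple_function_def algebra_simple_def UNIV)
  then show ?thesis
    by (simp add: nn_integral_eq_simple_integral simple_integral_def UNIV emeasure_eq_measure)
qed

lemma lower_semicont_eq_SUP_rectangles:
  fixes c :: "'a::second_countable_topology \<times> 'b::second_countable_topology \<Rightarrow> ennreal"
  assumes "lower_semicont c"
  shows "\<exists>(A :: nat \<Rightarrow> 'a set) (B :: nat \<Rightarrow> 'b set) (r :: nat \<Rightarrow> real).
    (\<forall>i. open (A i)) \<and> (\<forall>i. open (B i)) \<and> c = (\<lambda>x. SUP i. ennreal (r i) * indicator (A i \<times> B i) x)"
proof -
  obtain \<A> :: "'a set set" where \<A>: "countable \<A>" "topological_basis \<A>"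
    using ex_countable_basis by blast
  obtain \<B> :: "'b set set" where \<B>: "countable \<B>" "topological_basis \<B>"
    using ex_countable_basis by blast
  define S where "S = insert (0::rat, {}, {}) {(q, A, B). A \<in> \<A> \<and> B \<in> \<B> \<and> (\<forall>x \<in> A \<times> B. ennreal (of_rat q) \<le> c x)}"
  have "S \<subseteq> insert (0, {}, {}) (UNIV \<times> \<A> \<times> \<B>)" by (auto simp: S_def)
  then have S: "countable S"
    by (rule countable_subset) (use \<A> \<B> in auto)
  define s where "s = from_nat_into S"
  have s: "range s = S" unfolding s_def using S by (intro range_from_nat_into) (auto simp: S_def)
  define A where "A i = fst (snd (s i))" for i
  define B where "B i = snd (snd (s i))" for i
  define r where "r i = (of_rat (fst (s i)) :: real)" for i
  have si: "s i \<in> S" for i using s by auto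
  have "open (A i)" "open (B i)" for i
    using si[of i] topological_basis_open[OF \<A>(2)] topological_basis_open[OF \<B>(2)]
    by (auto simp: S_def A_def B_def)
  moreover have "c x = (SUP i. ennreal (r i) * indicator (A i \<times> B i) x)" for x
  proof (rule antisym)
    show "c x \<le> (SUP i. ennreal (r i) * indicator (A i \<times> B i) x)"
    proof (rule dense_le)
      fix y assume "y < c x"
      then obtain q :: rat where q: "y < ennreal (of_rat q)" "ennreal (of_rat q) < c x"
        using ennreal_rat_dense by blast
      have "open {z. ennreal (of_rat q) < c z}" by (rule lower_semicont_open) fact
      moreover have "(fst x, snd x) \<in> {z. ennreal (of_rat q) < c z}" using q by simp
      ultimately obtain U V where UV: "open U" "open V" "fst x \<in> U" "snd x \<in> V" "U \<times> V \<subseteq> {z. ennreal (of_rat q) < c z}"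
        by (auto elim!: open_prod_elim)
      obtain U' where U': "U' \<in> \<A>" "fst x \<in> U'" "U' \<subseteq> U"
        using topological_basisE[OF \<A>(2) UV(1,3)] .
      obtain V' where V': "V' \<in> \<B>" "snd x \<in> V'" "V' \<subseteq> V"
        using topological_basisE[OF \<B>(2) UV(2,4)] .
      have "(q, U', V') \<in> S"
      proof -
        have "U' \<times> V' \<subseteq> {z. ennreal (of_rat q) < c z}"
          using Sigma_mono[OF U'(3) V'(3)] UV(5) by (rule order_trans)
        then have "ennreal (of_rat q) \<le> c z" if "z \<in> U' \<times> V'" for z
          using that less_imp_le by blast
        then show ?thesis using U'(1) V'(1) by (simp add: S_def)
      qed
      then have "(q, U', V') \<in> range s" by (simp add: s)
      then obtain i where i: "s i = (q, U', V')" by auto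
      have "y \<le> ennreal (r i) * indicator (A i \<times> B i) x"
        using q U' V' by (simp add: i r_def A_def B_def indicator_def mem_Times_iff less_imp_le)
      then show "y \<le> (SUP i. ennreal (r i) * indicator (A i \<times> B i) x)"
        by (rule order_trans) (rule SUP_upper, simp)
    qed
    show "(SUP i. ennreal (r i) * indicator (A i \<times> B i) x) \<le> c x"
    proof (rule SUP_least)
      fix i
      show "ennreal (r i) * indicator (A i \<times> B i) x \<le> c x"
        using si[of i] by (auto simp: S_def A_def B_def r_def indicator_def)
    qed
  qed
  ultimately show ?thesis
    by (intro exI[of _ A] exI[of _ B] exI[of _ r]) (simp add: fun_eq_iff)
qed

lemma lower_semicont_nn_integral_limit:
  fixes c :: "'a::second_countable_topology \<times> 'b::second_countable_topology \<Rightarrow> ennreal"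
  assumes c: "lower_semicont c"
    and lim: "rectangle_limit G \<pi> P"
    and P: "P \<in> borel_probs" and \<pi>: "\<And>n. \<pi> n \<in> borel_probs"
    and G: "G \<noteq> bot" and L: "((\<lambda>n. \<integral>\<^sup>+x. c x \<partial>\<pi> n) \<longlongrightarrow> L) G"
  shows "(\<integral>\<^sup>+x. c x \<partial>P) \<le> L"
proof -
  obtain \<M> where \<M>: "algebra UNIV \<M>" "\<M> \<subseteq> sets borel"
      "\<And>A B. A \<in> sets borel \<Longrightarrow> B \<in> sets borel \<Longrightarrow> A \<times> B \<in> \<M>"
    and lim: "\<And>E. E \<in> \<M> \<Longrightarrow> ((\<lambda>n. measure (\<pi> n) E) \<longlongrightarrow> measure P E) G"
    using lim unfolding rectangle_limit_def by blast
  obtain A :: "nat \<Rightarrow> 'a set" and B :: "nat \<Rightarrow> 'b set" and r :: "nat \<Rightarrow> real"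
    where AB: "\<forall>i. open (A i)" "\<forall>i. open (B i)"
      and "c = (\<lambda>x. SUP i. ennreal (r i) * indicator (A i \<times> B i) x)"
    using lower_semicont_eq_SUP_rectangles[OF c] by (elim exE conjE) (rule that)
  then have c_SUP: "c x = (SUP i. ennreal (r i) * indicator (A i \<times> B i) x)" for x by simp
  define g where "g i x = ennreal (r i) * indicator (A i \<times> B i) x" for i :: nat and x
  define h where "h k x = (SUP i\<in>{..k}. g i x)" for k x
  have simple: "algebra_simple \<M> (h k)" for k
  proof (induction k)
    case 0
    have "h 0 = g 0" by (auto simp: h_def)
    then show ?case using \<M> AB by (simp add: g_def[abs_def] algebra_simple_indicator)
  next
    case (Suc k)
    have "algebra_simple \<M> (g (Suc k))"
      using \<M> AB by (simp add: g_def[abs_def] algebra_simple_indicator)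
    moreover have "h (Suc k) = (\<lambda>x. sup (g (Suc k) x) (h k x))"
      by (auto simp: h_def atMost_Suc)
    ultimately show ?case using algebra_simple_sup[OF \<M>(1)] Suc by simp
  qed
  have le: "h k x \<le> c x" for k x
    unfolding h_def c_SUP g_def by (rule SUP_subset_mono) auto
  have int_le: "(\<integral>\<^sup>+x. h k x \<partial>P) \<le> L" for k
  proof (rule tendsto_le[OF G L])
    have fin: "v < top" if "v \<in> range (h k)" for v
    proof -
      have "h k x < top" for x
      proof -
        have "g i x \<le> (\<Sum>i\<le>k. g i x)" if "i \<le> k" for i
          using that by (intro member_le_sum) auto
        then have "h k x \<le> (\<Sum>i\<le>k. g i x)" unfolding h_def by (auto intro: SUP_least)
        also have "\<dots> < top" by (auto simp: ennreal_sum_less_top g_def indicator_def)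
        finally show ?thesis .
      qed
      then show ?thesis using that by auto
    qed
    have "((\<lambda>n. \<Sum>v\<in>range (h k). v * ennreal (measure (\<pi> n) (h k -` {v}))) \<longlongrightarrow>
        (\<Sum>v\<in>range (h k). v * ennreal (measure P (h k -` {v})))) G"
      using simple[of k]
      by (intro tendsto_sum ennreal_tendsto_cmult fin tendsto_ennrealI lim) (auto simp: algebra_simple_def)
    then show "((\<lambda>n. \<integral>\<^sup>+x. h k x \<partial>\<pi> n) \<longlongrightarrow> (\<integral>\<^sup>+x. h k x \<partial>P)) G"
      using nn_integral_algebra_simple[OF simple \<M>(2)] P \<pi> by (simp add: borel_probs_def)
    show "\<forall>\<^sub>F n in G. (\<integral>\<^sup>+x. h k x \<partial>\<pi> n) \<le> (\<integral>\<^sup>+x. c x \<partial>\<pi> n)"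
      by (intro always_eventually allI nn_integral_mono le)
  qed
  have "h k \<in> borel_measurable P" for k
  proof -
    have "h k \<in> borel_measurable borel"
      using simple[of k] \<M>(2) by (auto simp: algebra_simple_def measurable_def)
    then show ?thesis using P by (simp add: borel_probs_def cong: measurable_cong_sets)
  qed
  moreover have "incseq h"
    by (auto simp: incseq_def le_fun_def h_def intro!: SUP_subset_mono)
  ultimately have "(\<integral>\<^sup>+x. (SUP k. h k x) \<partial>P) = (SUP k. \<integral>\<^sup>+x. h k x \<partial>P)"
    by (intro nn_integral_monotone_convergence_SUP)
  moreover have "c x = (SUP k. h k x)" for x
  proof (rule antisym)
    show "c x \<le> (SUP k. h k x)"
      unfolding c_SUP
    proof (rule SUP_least)
      fix i
      have "ennreal (r i) * indicator (A i \<times> B i) x \<le> h i x"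
        unfolding h_def g_def by (rule SUP_upper) simp
      also have "\<dots> \<le> (SUP k. h k x)" by (rule SUP_upper) simp
      finally show "ennreal (r i) * indicator (A i \<times> B i) x \<le> (SUP k. h k x)" .
    qed
  qed (auto intro: SUP_least le)
  ultimately show ?thesis using int_le by (auto intro: SUP_least)
qed

lemma couplings_nonempty:
  fixes \<mu> :: "'a::second_countable_topology measure" and \<nu> :: "'b::second_countable_topology measure"
  assumes "\<mu> \<in> borel_probs" "\<nu> \<in> borel_probs"
  shows "\<mu> \<Otimes>\<^sub>M \<nu> \<in> couplings \<mu> \<nu>"
proof -
  have \<mu>: "prob_space \<mu>" "sets \<mu> = sets borel" and \<nu>: "prob_space \<nu>" "sets \<nu> = sets borel"
    using assms by (auto simp: borel_probs_def)
  interpret pair_prob_space \<mu> \<nu>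
    using \<mu> \<nu> by (simp add: pair_prob_space_def pair_sigma_finite_def prob_space_imp_sigma_finite)
  have "sets (\<mu> \<Otimes>\<^sub>M \<nu>) = sets borel"
    unfolding borel_prod[symmetric] by (rule sets_pair_measure_cong[OF \<mu>(2) \<nu>(2)])
  moreover have "distr (\<mu> \<Otimes>\<^sub>M \<nu>) borel fst = \<mu>"
    using M2.distr_pair_fst[of \<mu>] distr_cong[OF refl, of \<mu> borel "\<mu> \<Otimes>\<^sub>M \<nu>" fst fst] \<mu> by simp
  moreover have "distr (\<mu> \<Otimes>\<^sub>M \<nu>) borel snd = \<nu>"
  proof (rule measure_eqI)
    fix B assume "B \<in> sets (distr (\<mu> \<Otimes>\<^sub>M \<nu>) borel snd)"
    then have B: "B \<in> sets \<nu>" using \<nu> by simp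
    have "snd -` B \<inter> space (\<mu> \<Otimes>\<^sub>M \<nu>) = space \<mu> \<times> B"
      using sets.sets_into_space[OF B] by (auto simp: space_pair_measure)
    then show "emeasure (distr (\<mu> \<Otimes>\<^sub>M \<nu>) borel snd) B = emeasure \<nu> B"
      using B \<nu> by (simp add: emeasure_distr M2.emeasure_pair_measure_Times M1.emeasure_space_1 cong: measurable_cong_sets)
  qed (use \<nu> in simp)
  ultimately show ?thesis
    using prob_space_axioms by (simp add: couplings_def borel_probs_def)
qed

proposition opt_couplings_nonempty:
  fixes \<mu> :: "'a::{second_countable_topology, complete_space} measure"
    and \<nu> :: "'b::{second_countable_topology, complete_space} measure"
  assumes "lower_semicont c" "\<mu> \<in> borel_probs" "\<nu> \<in> borel_probs"
  obtains \<pi> where "\<pi> \<in> opt_couplings c \<mu> \<nu>"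
proof -
  let ?I = "\<lambda>\<pi>. \<integral>\<^sup>+x. c x \<partial>\<pi>"
  have "?I ` couplings \<mu> \<nu> \<noteq> {}" using couplings_nonempty[OF assms(2,3)] by auto
  from ennreal_Inf_countable_INF[OF this]
  obtain f :: "nat \<Rightarrow> ennreal" where f: "decseq f" "range f \<subseteq> ?I ` couplings \<mu> \<nu>" "OT_cost c \<mu> \<nu> = (INF i. f i)"
    unfolding OT_cost_def by blast
  from f(2) have "\<forall>n. \<exists>\<pi>\<in>couplings \<mu> \<nu>. f n = ?I \<pi>" by blast
  then obtain \<pi> where \<pi>: "\<And>n. \<pi> n \<in> couplings \<mu> \<nu>" and f_eq: "\<And>n. f n = ?I (\<pi> n)" by metis
  obtain P G where P: "P \<in> couplings \<mu> \<nu>" and G: "G \<noteq> bot" "G \<le> sequentially"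
    and lim: "rectangle_limit G \<pi> P"
    by (rule couplings_limit[of \<pi>, OF \<pi>])
  have "f \<longlonglongrightarrow> OT_cost c \<mu> \<nu>" unfolding f(3) by (rule LIMSEQ_INF) fact
  then have "((\<lambda>n. ?I (\<pi> n)) \<longlongrightarrow> OT_cost c \<mu> \<nu>) G"
    using tendsto_mono[OF G(2)] by (simp flip: f_eq)
  then have "?I P \<le> OT_cost c \<mu> \<nu>"
    using lower_semicont_nn_integral_limit[OF assms(1) lim _ _ G(1)] P \<pi> by (simp add: couplings_def)
  then have "P \<in> opt_couplings c \<mu> \<nu>"
    using P unfolding opt_couplings_def OT_cost_def by (auto intro: order_trans INF_lower)
  then show ?thesis by (rule that)
qed

subsection \<open>Gluing\<close>

text \<open>Conditionally on the common block of the two \<open>'b\<close>-components, \<open>\<pi>\<close> and \<open>\<pi>'\<close> are coupled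
  independently. The divisor vanishes only on null blocks.\<close>

lemma blockwise_coupling:
  fixes \<pi> :: "('a::second_countable_topology \<times> 'b::second_countable_topology) measure"
    and \<pi>' :: "('c::second_countable_topology \<times> 'b) measure"
  assumes \<pi>: "\<pi> \<in> borel_probs" and \<pi>': "\<pi>' \<in> borel_probs"
    and eq: "distr \<pi> borel snd = distr \<pi>' borel snd"
    and fin: "finite (range f)" and f: "\<And>i. f -` {i} \<in> sets (borel :: 'b measure)"
  shows "\<exists>\<Theta>\<in>couplings \<pi> \<pi>'. \<forall>B\<in>sets borel. (\<forall>y w. f y = f w \<longrightarrow> (y \<in> B \<longleftrightarrow> w \<in> B)) \<longrightarrow>
    emeasure \<Theta> ((UNIV \<times> B) \<times> (UNIV \<times> - B)) = 0"
proof -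
  have s: "sets \<pi> = sets borel" "space \<pi> = UNIV" "sets \<pi>' = sets borel" "space \<pi>' = UNIV"
    and p: "prob_space \<pi>" "prob_space \<pi>'"
    using \<pi> \<pi>' sets_eq_imp_space_eq[of \<pi> borel] sets_eq_imp_space_eq[of \<pi>' borel]
    by (auto simp: borel_probs_def)
  interpret pair_prob_space \<pi> \<pi>'
    using p by (simp add: pair_prob_space_def pair_sigma_finite_def prob_space_imp_sigma_finite)
  have UB: "UNIV \<times> B \<in> sets \<pi>" "UNIV \<times> B \<in> sets \<pi>'" if "B \<in> sets borel" for B
    using that by (simp_all add: s flip: borel_prod)
  define S where "S i = (UNIV :: 'a set) \<times> f -` {i}" for i
  define T where "T i = (UNIV :: 'c set) \<times> f -` {i}" for i
  have ST[measurable]: "S i \<in> sets \<pi>" "T i \<in> sets \<pi>'" for i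
    by (auto simp: S_def T_def f intro!: UB)
  have S_eq_T: "emeasure \<pi>' (T i) = emeasure \<pi> (S i)" for i
  proof -
    have "snd \<in> \<pi> \<rightarrow>\<^sub>M borel" "snd \<in> \<pi>' \<rightarrow>\<^sub>M borel"
      using s by (simp_all cong: measurable_cong_sets flip: borel_prod)
    then show ?thesis
      using arg_cong[OF eq, of "\<lambda>M. emeasure M (f -` {i})"] f[of i]
      by (simp add: emeasure_distr s S_def T_def snd_vimage_eq_Times)
  qed
  define g where "g x = (\<Sum>i\<in>range f. inverse (emeasure \<pi> (S i)) * indicator (S i \<times> T i) x)" for x
  have [measurable]: "g \<in> borel_measurable (\<pi> \<Otimes>\<^sub>M \<pi>')"
    unfolding g_def by measurable
  define \<Theta> where "\<Theta> = density (\<pi> \<Otimes>\<^sub>M \<pi>') g"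
  have rect: "emeasure \<Theta> (A \<times> B) = (\<Sum>i\<in>range f. inverse (emeasure \<pi> (S i)) * (emeasure \<pi> (A \<inter> S i) * emeasure \<pi>' (B \<inter> T i)))"
    if [measurable]: "A \<in> sets \<pi>" "B \<in> sets \<pi>'" for A B
  proof -
    have "emeasure \<Theta> (A \<times> B) = (\<integral>\<^sup>+x. g x * indicator (A \<times> B) x \<partial>(\<pi> \<Otimes>\<^sub>M \<pi>'))"
      unfolding \<Theta>_def by (rule emeasure_density) auto
    also have "\<dots> = (\<integral>\<^sup>+x. (\<Sum>i\<in>range f. inverse (emeasure \<pi> (S i)) * indicator ((A \<inter> S i) \<times> (B \<inter> T i)) x) \<partial>(\<pi> \<Otimes>\<^sub>M \<pi>'))"
      unfolding g_def sum_distrib_right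
      by (intro nn_integral_cong sum.cong refl) (auto simp: indicator_def)
    also have "\<dots> = (\<Sum>i\<in>range f. \<integral>\<^sup>+x. inverse (emeasure \<pi> (S i)) * indicator ((A \<inter> S i) \<times> (B \<inter> T i)) x \<partial>(\<pi> \<Otimes>\<^sub>M \<pi>'))"
      by (rule nn_integral_sum) measurable
    also have "\<dots> = (\<Sum>i\<in>range f. inverse (emeasure \<pi> (S i)) * (emeasure \<pi> (A \<inter> S i) * emeasure \<pi>' (B \<inter> T i)))"
      by (intro sum.cong refl) (simp add: nn_integral_cmult_indicator M2.emeasure_pair_measure_Times)
    finally show ?thesis .
  qed
  have cancel: "inverse (emeasure \<pi> (S i)) * (a * emeasure \<pi> (S i)) = a" if "a \<le> emeasure \<pi> (S i)" for a i
  proof (cases "emeasure \<pi> (S i) = 0")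
    case False
    then show ?thesis
      using mult_divide_eq_ennreal[of "emeasure \<pi> (S i)" a] M1.emeasure_finite
      by (simp add: divide_ennreal_def mult.commute)
  qed (use that in simp)
  have split: "emeasure M A = (\<Sum>i\<in>range f. emeasure M (A \<inter> Q -` {i}))"
    if "prob_space M" "space M = UNIV" "A \<in> sets M" "\<And>i. Q -` {i} \<in> sets M" "range Q \<subseteq> range f"
    for M :: "'z measure" and A and Q
  proof -
    have "(\<Sum>i\<in>range f. emeasure M (A \<inter> Q -` {i})) = emeasure M (\<Union>i\<in>range f. A \<inter> Q -` {i})"
      by (rule sum_emeasure) (use that fin in \<open>auto simp: disjoint_family_on_def\<close>)
    also have "(\<Union>i\<in>range f. A \<inter> Q -` {i}) = A"
      using subsetD[OF that(5) rangeI] by blast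
    finally show ?thesis ..
  qed
  have S_vim: "S i = (\<lambda>x. f (snd x)) -` {i}" and T_vim: "T i = (\<lambda>x. f (snd x)) -` {i}" for i
    by (auto simp: S_def T_def)
  have fst: "emeasure \<Theta> (A \<times> UNIV) = emeasure \<pi> A" if A: "A \<in> sets \<pi>" for A
  proof -
    have "emeasure \<Theta> (A \<times> UNIV) = (\<Sum>i\<in>range f. emeasure \<pi> (A \<inter> S i))"
      using rect[OF A, of UNIV] ST A
      by (simp add: S_eq_T s) (intro sum.cong refl cancel emeasure_mono, auto simp: s)
    also have "\<dots> = emeasure \<pi> A"
      unfolding S_vim by (rule split[symmetric]) (use p s A ST in \<open>auto simp flip: S_vim\<close>)
    finally show ?thesis .
  qed
  have snd: "emeasure \<Theta> (UNIV \<times> B) = emeasure \<pi>' B" if B: "B \<in> sets \<pi>'" for B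
  proof -
    have "emeasure \<Theta> (UNIV \<times> B) = (\<Sum>i\<in>range f. emeasure \<pi>' (B \<inter> T i))"
      using rect[OF _ B, of UNIV] ST B
      by (simp add: s mult.commute[of "emeasure \<pi> _" "emeasure \<pi>' _"])
        (intro sum.cong refl cancel, auto simp: s simp flip: S_eq_T intro!: emeasure_mono)
    also have "\<dots> = emeasure \<pi>' B"
      unfolding T_vim by (rule split[symmetric]) (use p s B ST in \<open>auto simp flip: T_vim\<close>)
    finally show ?thesis .
  qed
  have sets: "sets \<Theta> = sets borel"
    unfolding \<Theta>_def sets_density borel_prod[symmetric] using sets_pair_measure_cong[OF s(1) s(3)] borel_prod by metis
  then have space: "space \<Theta> = UNIV" using sets_eq_imp_space_eq by fastforce
  have "emeasure \<Theta> UNIV = 1"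
    using fst[of UNIV] M1.emeasure_space_1 by (simp add: s)
  then have "prob_space \<Theta>" by (intro prob_spaceI) (simp add: space)
  have "\<Theta> \<in> couplings \<pi> \<pi>'"
  proof -
    have fs: "fst \<in> \<Theta> \<rightarrow>\<^sub>M borel" "snd \<in> \<Theta> \<rightarrow>\<^sub>M borel"
      using sets by (simp_all cong: measurable_cong_sets flip: borel_prod[where 'a="'a \<times> 'b"])
    have "distr \<Theta> borel fst = \<pi>"
      using fs(1) fst by (intro measure_eqI) (auto simp: s emeasure_distr space fst_vimage_eq_Times)
    moreover have "distr \<Theta> borel snd = \<pi>'"
      using fs(2) snd by (intro measure_eqI) (auto simp: s emeasure_distr space snd_vimage_eq_Times)
    ultimately show ?thesis
      using \<open>prob_space \<Theta>\<close> sets by (simp add: couplings_def borel_probs_def)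
  qed
  moreover have "emeasure \<Theta> ((UNIV \<times> B) \<times> (UNIV \<times> - B)) = 0"
    if B: "B \<in> sets borel" and sat: "\<And>y w. f y = f w \<Longrightarrow> y \<in> B \<longleftrightarrow> w \<in> B" for B
  proof -
    have "(UNIV \<times> B) \<inter> S i = {} \<or> (UNIV \<times> - B) \<inter> T i = {}" for i
      using sat by (auto simp: S_def T_def)
    then have "emeasure \<pi> ((UNIV \<times> B) \<inter> S i) * emeasure \<pi>' ((UNIV \<times> - B) \<inter> T i) = 0" for i
      by (metis emeasure_empty mult_zero_left mult_zero_right)
    then have "(\<Sum>i\<in>range f. inverse (emeasure \<pi> (S i)) *
        (emeasure \<pi> ((UNIV \<times> B) \<inter> S i) * emeasure \<pi>' ((UNIV \<times> - B) \<inter> T i))) = 0"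
      by (simp only: mult_zero_right sum.neutral_const)
    then show ?thesis
      using rect[OF UB(1)[OF B] UB(2), of "- B"] B by simp
  qed
  ultimately show ?thesis by blast
qed

proposition gluing:
  fixes \<pi> :: "('a::{second_countable_topology, complete_space} \<times> 'b::{second_countable_topology, complete_space}) measure"
    and \<pi>' :: "('c::{second_countable_topology, complete_space} \<times> 'b) measure"
  assumes \<pi>: "\<pi> \<in> borel_probs" and \<pi>': "\<pi>' \<in> borel_probs"
    and eq: "distr \<pi> borel snd = distr \<pi>' borel snd"
  obtains \<theta> :: "('a \<times> 'b \<times> 'c) measure" where "\<theta> \<in> borel_probs"
    "distr \<theta> borel (\<lambda>(x, y, z). (x, y)) = \<pi>" "distr \<theta> borel (\<lambda>(x, y, z). (z, y)) = \<pi>'"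
proof -
  obtain \<B> :: "'b set set" where \<B>: "countable \<B>" "topological_basis \<B>"
    using ex_countable_basis by blast
  define B where "B = from_nat_into (insert {} \<B>)"
  have range_B: "range B = insert {} \<B>"
    unfolding B_def using \<B>(1) by (intro range_from_nat_into) auto
  then have B_open: "open (B i)" for i
    using topological_basis_open[OF \<B>(2)] by (metis insert_iff open_empty rangeI)
  define f where "f k y = {i. i < k \<and> y \<in> B i}" for k :: nat and y
  define Q where "Q k \<Theta> \<longleftrightarrow> \<Theta> \<in> couplings \<pi> \<pi>' \<and> (\<forall>i<k.
      emeasure \<Theta> ((UNIV \<times> B i) \<times> (UNIV \<times> - B i)) = 0 \<and>
      emeasure \<Theta> ((UNIV \<times> - B i) \<times> (UNIV \<times> B i)) = 0)" for k \<Theta>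
  have "\<exists>\<Theta>. Q k \<Theta>" for k
  proof -
    have "range (f k) \<subseteq> Pow {..<k}" by (auto simp: f_def)
    then have fin: "finite (range (f k))" by (rule finite_subset) simp
    have meas: "f k -` {I} \<in> sets borel" for I
    proof -
      have [measurable]: "B i \<in> sets borel" for i using B_open by (simp add: borel_open)
      have "{y\<in>space borel. \<forall>i. (i < k \<and> y \<in> B i) = (i \<in> I)} \<in> sets borel"
        by measurable
      also have "{y\<in>space borel. \<forall>i. (i < k \<and> y \<in> B i) = (i \<in> I)} = f k -` {I}"
        by (simp add: f_def vimage_def set_eq_iff)
      finally show ?thesis .
    qed
    obtain \<Theta> where \<Theta>: "\<Theta> \<in> couplings \<pi> \<pi>'"
      and null: "\<forall>B\<in>sets borel. (\<forall>y w. f k y = f k w \<longrightarrow> (y \<in> B \<longleftrightarrow> w \<in> B)) \<longrightarrow>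
        emeasure \<Theta> ((UNIV \<times> B) \<times> (UNIV \<times> - B)) = 0"
      using blockwise_coupling[OF \<pi> \<pi>' eq fin meas] by blast
    have "emeasure \<Theta> ((UNIV \<times> B i) \<times> (UNIV \<times> - B i)) = 0 \<and>
        emeasure \<Theta> ((UNIV \<times> - B i) \<times> (UNIV \<times> B i)) = 0" if "i < k" for i
    proof -
      have sat: "y \<in> B i \<longleftrightarrow> w \<in> B i" if "f k y = f k w" for y w
        using that \<open>i < k\<close> by (auto simp: f_def set_eq_iff)
      have b: "B i \<in> sets borel" "- B i \<in> sets borel"
        using B_open[of i] by (auto simp: borel_open)
      have sats: "\<forall>y w. f k y = f k w \<longrightarrow> (y \<in> B i \<longleftrightarrow> w \<in> B i)"
        "\<forall>y w. f k y = f k w \<longrightarrow> (y \<in> - B i \<longleftrightarrow> w \<in> - B i)"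
        using sat by blast+
      show ?thesis
        using null[THEN bspec, OF b(1), THEN mp, OF sats(1)] null[THEN bspec, OF b(2), THEN mp, OF sats(2)]
        by simp
    qed
    with \<Theta> show ?thesis unfolding Q_def by blast
  qed
  then obtain \<Theta> where "Q k (\<Theta> k)" for k by metis
  then have \<Theta>: "\<Theta> k \<in> couplings \<pi> \<pi>'"
    and null: "i < k \<Longrightarrow> emeasure (\<Theta> k) ((UNIV \<times> B i) \<times> (UNIV \<times> - B i)) = 0"
      "i < k \<Longrightarrow> emeasure (\<Theta> k) ((UNIV \<times> - B i) \<times> (UNIV \<times> B i)) = 0" for k i
    by (simp_all add: Q_def)
  obtain P G where P: "P \<in> couplings \<pi> \<pi>'" and G: "G \<noteq> bot" "G \<le> sequentially"
    and lim: "rectangle_limit G \<Theta> P"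
    by (rule couplings_limit[of \<Theta>, OF \<Theta>])
  interpret P: prob_space P by (rule couplingsD[OF P])
  have setsP: "sets P = sets borel" "space P = UNIV" using couplingsD[OF P] by auto
  have lim: "((\<lambda>n. measure (\<Theta> n) (C \<times> D)) \<longlongrightarrow> measure P (C \<times> D)) G"
    if "C \<in> sets borel" "D \<in> sets borel" for C D
    using lim that unfolding rectangle_limit_def by blast
  have null_P: "C \<times> D \<in> null_sets P"
    if b: "C \<in> sets borel" "D \<in> sets borel" and 0: "\<And>k. i < k \<Longrightarrow> emeasure (\<Theta> k) (C \<times> D) = 0" for i :: nat and C D
  proof -
    have "eventually (\<lambda>k. i < k) G" by (rule filter_leD[OF G(2)]) (rule eventually_gt_at_top)
    then have "eventually (\<lambda>k. measure (\<Theta> k) (C \<times> D) = 0) G"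
      by (rule eventually_mono) (simp add: measure_def 0)
    then have "((\<lambda>k. measure (\<Theta> k) (C \<times> D)) \<longlongrightarrow> 0) G" by (rule tendsto_eventually)
    then have "measure P (C \<times> D) = 0" using tendsto_unique[OF G(1) lim[OF b]] by simp
    moreover have "C \<times> D \<in> sets P" using b by (simp add: setsP flip: borel_prod[where 'a="'a \<times> 'b"])
    ultimately show ?thesis by (simp add: null_sets_def P.emeasure_eq_measure)
  qed
  have UB: "(UNIV :: 'a set) \<times> B i \<in> sets borel" "(UNIV :: 'a set) \<times> - B i \<in> sets borel"
    "(UNIV :: 'c set) \<times> B i \<in> sets borel" "(UNIV :: 'c set) \<times> - B i \<in> sets borel" for i
    using B_open[of i] by (simp_all add: borel_open flip: borel_prod)
  have "AE p in P. snd (fst p) \<in> B i \<longleftrightarrow> snd (snd p) \<in> B i" for i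
    by (rule AE_I'[OF null_sets.Un[OF null_P[OF UB(1) UB(4) null(1), of i i] null_P[OF UB(2) UB(3) null(2), of i i]]]) auto
  then have "AE p in P. \<forall>i. snd (fst p) \<in> B i \<longleftrightarrow> snd (snd p) \<in> B i"
    by (simp add: AE_all_countable)
  then have AE_eq: "AE p in P. snd (fst p) = snd (snd p)"
  proof (rule AE_mp, intro AE_I2 impI)
    fix p :: "('a \<times> 'b) \<times> 'c \<times> 'b"
    assume *: "\<forall>i. snd (fst p) \<in> B i \<longleftrightarrow> snd (snd p) \<in> B i"
    show "snd (fst p) = snd (snd p)"
    proof (rule ccontr)
      assume "snd (fst p) \<noteq> snd (snd p)"
      then obtain U where U: "open U" "snd (fst p) \<in> U" "snd (snd p) \<notin> U" by (rule t1_space_class.t1_space[THEN exE]) auto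
      obtain U' where "U' \<in> \<B>" "snd (fst p) \<in> U'" "U' \<subseteq> U"
        using topological_basisE[OF \<B>(2) U(1,2)] .
      moreover from this obtain i where "U' = B i" using range_B by (metis insertCI rangeE)
      ultimately show False using * U by auto
    qed
  qed
  define h where "h = (\<lambda>p::('a \<times> 'b) \<times> 'c \<times> 'b. (fst (fst p), snd (fst p), fst (snd p)))"
  have cont: "continuous_on UNIV h" unfolding h_def by (intro continuous_intros)
  have h[measurable]: "h \<in> P \<rightarrow>\<^sub>M borel"
    using borel_measurable_continuous_onI[OF cont] setsP by (simp cong: measurable_cong_sets)
  define \<theta> where "\<theta> = distr P borel h"
  have m: "(\<lambda>(x, y, z). (x, y)) \<in> borel \<rightarrow>\<^sub>M (borel :: ('a \<times> 'b) measure)"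
    "(\<lambda>(x, y, z). (z, y)) \<in> borel \<rightarrow>\<^sub>M (borel :: ('c \<times> 'b) measure)"
    unfolding split_def by (intro borel_measurable_continuous_onI continuous_intros)+
  have "\<theta> \<in> borel_probs"
    using P.prob_space_distr[OF h] by (simp add: \<theta>_def borel_probs_def)
  moreover have "distr \<theta> borel (\<lambda>(x, y, z). (x, y)) = \<pi>"
  proof -
    have "distr \<theta> borel (\<lambda>(x, y, z). (x, y)) = distr P borel fst"
      unfolding \<theta>_def distr_distr[OF m(1) h] by (simp add: h_def comp_def)
    then show ?thesis using couplingsD[OF P] by simp
  qed
  moreover have "distr \<theta> borel (\<lambda>(x, y, z). (z, y)) = \<pi>'"
  proof -
    have "distr \<theta> borel (\<lambda>(x, y, z). (z, y)) = distr P borel (\<lambda>p. (fst (snd p), snd (fst p)))"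
      unfolding \<theta>_def distr_distr[OF m(2) h] by (simp add: h_def comp_def)
    also have "\<dots> = distr P borel snd"
    proof (rule distr_cong_AE)
      show "AE p in P. (fst (snd p), snd (fst p)) = snd p"
        using AE_eq by (rule AE_mp) (auto intro!: AE_I2 simp: prod_eq_iff)
      have "continuous_on UNIV (\<lambda>p::('a \<times> 'b) \<times> 'c \<times> 'b. (fst (snd p), snd (fst p)))"
        by (intro continuous_intros)
      then show "(\<lambda>p. (fst (snd p), snd (fst p))) \<in> P \<rightarrow>\<^sub>M borel"
        using borel_measurable_continuous_onI setsP by (simp cong: measurable_cong_sets)
      have "continuous_on UNIV (snd :: ('a \<times> 'b) \<times> 'c \<times> 'b \<Rightarrow> _)" by (intro continuous_intros)
      then show "snd \<in> P \<rightarrow>\<^sub>M borel"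
        using borel_measurable_continuous_onI setsP by (simp cong: measurable_cong_sets)
    qed (rule refl)+
    finally show ?thesis using couplingsD[OF P] by simp
  qed
  ultimately show ?thesis by (rule that)
qed

subsection \<open>Superdifferentials\<close>

lemma plans_fin_couplings:
  "\<pi> \<in> plans_fin a\<^sub>1 a\<^sub>2 \<Longrightarrow> \<pi> \<in> couplings (distr \<pi> borel fst) (distr \<pi> borel snd)"
  by (simp add: plans_fin_def couplings_def)

lemma OT_cost_le: "\<pi> \<in> couplings \<mu> \<nu> \<Longrightarrow> OT_cost c \<mu> \<nu> \<le> (\<integral>\<^sup>+x. c x \<partial>\<pi>)"
  unfolding OT_cost_def by (rule INF_lower)

lemma opt_couplings_iff:
  "\<pi> \<in> opt_couplings c \<mu> \<nu> \<longleftrightarrow> \<pi> \<in> couplings \<mu> \<nu> \<and> (\<integral>\<^sup>+x. c x \<partial>\<pi>) = OT_cost c \<mu> \<nu>"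
proof -
  have "(\<forall>\<pi>'\<in>couplings \<mu> \<nu>. (\<integral>\<^sup>+x. c x \<partial>\<pi>) \<le> (\<integral>\<^sup>+x. c x \<partial>\<pi>')) \<longleftrightarrow> (\<integral>\<^sup>+x. c x \<partial>\<pi>) \<le> OT_cost c \<mu> \<nu>"
    by (simp add: OT_cost_def le_INF_iff)
  then show ?thesis
    using OT_cost_le[of \<pi> \<mu> \<nu> c] by (auto simp: opt_couplings_def)
qed

lemma integral_cost_difference:
  fixes c :: "'a::second_countable_topology \<times> 'b::second_countable_topology \<Rightarrow> ennreal"
  assumes c: "c \<in> borel_measurable borel" and \<theta>: "\<theta> \<in> (borel_probs :: ('a \<times> 'b \<times> 'a) measure set)"
    and \<pi>: "distr \<theta> borel (\<lambda>(x, y, z). (x, y)) = \<pi>" "(\<integral>\<^sup>+x. c x \<partial>\<pi>) < \<infinity>"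
    and \<pi>': "distr \<theta> borel (\<lambda>(x, y, z). (z, y)) = \<pi>'" "(\<integral>\<^sup>+x. c x \<partial>\<pi>') < \<infinity>"
  shows "(\<integral>(x, y, z). enn2real (c (x, y)) - enn2real (c (z, y)) \<partial>\<theta>) =
    enn2real (\<integral>\<^sup>+x. c x \<partial>\<pi>) - enn2real (\<integral>\<^sup>+x. c x \<partial>\<pi>')"
proof -
  have integrable_cost: "integrable M (\<lambda>x. enn2real (f x)) \<and> (\<integral>x. enn2real (f x) \<partial>M) = enn2real (\<integral>\<^sup>+x. f x \<partial>M)"
    if [measurable]: "f \<in> borel_measurable M" and fin: "(\<integral>\<^sup>+x. f x \<partial>M) < \<infinity>" for f and M :: "('a \<times> 'b \<times> 'a) measure"
  proof -
    have "AE x in M. f x \<noteq> \<infinity>"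
      by (rule nn_integral_PInf_AE) (use fin in auto)
    then have *: "(\<integral>\<^sup>+x. ennreal (enn2real (f x)) \<partial>M) = (\<integral>\<^sup>+x. f x \<partial>M)"
      by (intro nn_integral_cong_AE) (auto simp: less_top)
    have "integrable M (\<lambda>x. enn2real (f x))"
      by (rule integrableI_nonneg) (use fin * in auto)
    moreover have "(\<integral>x. enn2real (f x) \<partial>M) = enn2real (\<integral>\<^sup>+x. f x \<partial>M)"
      using * by (simp add: integral_eq_nn_integral)
    ultimately show ?thesis by simp
  qed
  have sets: "sets \<theta> = sets borel" using \<theta> by (simp add: borel_probs_def)
  have m: "(\<lambda>(x, y, z). (x, y)) \<in> \<theta> \<rightarrow>\<^sub>M (borel :: ('a \<times> 'b) measure)"
    "(\<lambda>(x, y, z). (z, y)) \<in> \<theta> \<rightarrow>\<^sub>M (borel :: ('a \<times> 'b) measure)"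
    unfolding measurable_cong_sets[OF sets refl] split_def
    by (intro borel_measurable_continuous_onI continuous_intros)+
  have "(\<integral>\<^sup>+x. c x \<partial>\<pi>) = (\<integral>\<^sup>+(x, y, z). c (x, y) \<partial>\<theta>)"
    unfolding \<pi>(1)[symmetric] by (subst nn_integral_distr[OF m(1)]) (use c in \<open>auto simp: split_def\<close>)
  moreover have "(\<integral>\<^sup>+x. c x \<partial>\<pi>') = (\<integral>\<^sup>+(x, y, z). c (z, y) \<partial>\<theta>)"
    unfolding \<pi>'(1)[symmetric] by (subst nn_integral_distr[OF m(2)]) (use c in \<open>auto simp: split_def\<close>)
  moreover have "(\<lambda>(x, y, z). c (x, y)) \<in> borel_measurable \<theta>" "(\<lambda>(x, y, z). c (z, y)) \<in> borel_measurable \<theta>"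
    using measurable_compose[OF m(1) c] measurable_compose[OF m(2) c] by (simp_all add: split_def)
  ultimately show ?thesis
    using integrable_cost[of "\<lambda>(x, y, z). c (x, y)" \<theta>] integrable_cost[of "\<lambda>(x, y, z). c (z, y)" \<theta>] \<pi>(2) \<pi>'(2)
    by (simp add: split_def)
qed

locale transport_cost =
  fixes a\<^sub>1 :: "'a::polish_space \<Rightarrow> ennreal"
    and a\<^sub>2 :: "'b::polish_space \<Rightarrow> ennreal"
    and c :: "'a \<times> 'b \<Rightarrow> ennreal"
  assumes a\<^sub>1_measurable: "a\<^sub>1 \<in> borel_measurable borel"
    and a\<^sub>2_measurable: "a\<^sub>2 \<in> borel_measurable borel"
    and c_lsc: "lower_semicont c"
    and c_le: "c (x\<^sub>1, x\<^sub>2) \<le> a\<^sub>1 x\<^sub>1 + a\<^sub>2 x\<^sub>2"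
begin

lemma c_measurable: "c \<in> borel_measurable borel"
  by (rule lower_semicont_measurable[OF c_lsc])

lemma cost_finite:
  assumes \<mu>: "\<mu> \<in> probs_fin a\<^sub>1" and \<nu>: "\<nu> \<in> probs_fin a\<^sub>2" and \<pi>: "\<pi> \<in> couplings \<mu> \<nu>"
  shows "(\<integral>\<^sup>+x. c x \<partial>\<pi>) < \<infinity>"
proof -
  have m[measurable]: "fst \<in> \<pi> \<rightarrow>\<^sub>M borel" "snd \<in> \<pi> \<rightarrow>\<^sub>M borel"
    using couplingsD(2)[OF \<pi>] by (simp_all cong: measurable_cong_sets flip: borel_prod)
  note a\<^sub>1_measurable[measurable] a\<^sub>2_measurable[measurable]
  have "(\<integral>\<^sup>+x. c x \<partial>\<pi>) \<le> (\<integral>\<^sup>+x. a\<^sub>1 (fst x) + a\<^sub>2 (snd x) \<partial>\<pi>)"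
    by (rule nn_integral_mono) (use c_le in auto)
  also have "\<dots> = (\<integral>\<^sup>+x. a\<^sub>1 (fst x) \<partial>\<pi>) + (\<integral>\<^sup>+x. a\<^sub>2 (snd x) \<partial>\<pi>)"
    by (rule nn_integral_add) measurable
  also have "\<dots> = (\<integral>\<^sup>+x. a\<^sub>1 x \<partial>\<mu>) + (\<integral>\<^sup>+x. a\<^sub>2 x \<partial>\<nu>)"
    unfolding couplingsD(4)[OF \<pi>, symmetric] couplingsD(5)[OF \<pi>, symmetric]
    by (simp add: nn_integral_distr)
  also have "\<dots> < \<infinity>" using \<mu> \<nu> by (simp add: probs_fin_def)
  finally show ?thesis .
qed

lemma opt_coupling_exists:
  assumes "\<mu> \<in> probs_fin a\<^sub>1" "\<nu> \<in> probs_fin a\<^sub>2"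
  obtains \<pi> where "\<pi> \<in> opt_couplings c \<mu> \<nu>" "\<pi> \<in> plans_fin a\<^sub>1 a\<^sub>2"
proof -
  obtain \<pi> where \<pi>: "\<pi> \<in> opt_couplings c \<mu> \<nu>"
    using opt_couplings_nonempty[OF c_lsc, of \<mu> \<nu>] assms by (auto simp: probs_fin_def)
  then have "\<pi> \<in> plans_fin a\<^sub>1 a\<^sub>2"
    using assms by (auto simp: opt_couplings_def couplings_def plans_fin_def)
  with \<pi> show ?thesis by (rule that)
qed

lemma OT_cost_real:
  assumes "\<mu> \<in> probs_fin a\<^sub>1" "\<nu> \<in> probs_fin a\<^sub>2"
  obtains r where "OT_cost c \<mu> \<nu> = ennreal r" "0 \<le> r"
proof -
  obtain \<pi> where \<pi>: "\<pi> \<in> opt_couplings c \<mu> \<nu>" using opt_coupling_exists[OF assms] .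
  then have "OT_cost c \<mu> \<nu> < \<infinity>"
    using cost_finite[OF assms, of \<pi>] by (simp add: opt_couplings_iff)
  then show ?thesis using that by (cases "OT_cost c \<mu> \<nu>") auto
qed

lemma total_C_superdiff_iff_couplings:
  "\<pi> \<in> total_C_superdiff a\<^sub>1 a\<^sub>2 c \<phi> \<longleftrightarrow> \<pi> \<in> plans_fin a\<^sub>1 a\<^sub>2 \<and>
     (\<forall>\<mu>\<in>probs_fin a\<^sub>1. \<forall>\<pi>'\<in>couplings \<mu> (distr \<pi> borel snd).
        ereal (enn2real (\<integral>\<^sup>+x. c x \<partial>\<pi>) - enn2real (\<integral>\<^sup>+x. c x \<partial>\<pi>')) \<le> \<phi> (distr \<pi> borel fst) - \<phi> \<mu>)"
  (is "_ \<longleftrightarrow> _ \<and> ?R")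
proof -
  have proj: "distr (distr \<theta> borel (\<lambda>(x, y, z). (x, y))) borel fst = distr \<theta> borel (\<lambda>(x, y, z). x)"
    "distr (distr \<theta> borel (\<lambda>(x, y, z). (x, y))) borel snd = distr \<theta> borel (\<lambda>(x, y, z). y)"
    "distr (distr \<theta> borel (\<lambda>(x, y, z). (z, y))) borel fst = distr \<theta> borel (\<lambda>(x, y, z). z)"
    "distr (distr \<theta> borel (\<lambda>(x, y, z). (z, y))) borel snd = distr \<theta> borel (\<lambda>(x, y, z). y)"
    and zy: "distr \<theta> borel (\<lambda>(x, y, z). (z, y)) \<in> borel_probs"
    if \<theta>: "\<theta> \<in> borel_probs" for \<theta> :: "('a \<times> 'b \<times> 'a) measure"
  proof -
    have sets: "sets \<theta> = sets borel" using \<theta> by (simp add: borel_probs_def)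
    have m: "(\<lambda>(x, y, z). (x, y)) \<in> \<theta> \<rightarrow>\<^sub>M (borel :: ('a \<times> 'b) measure)"
      "(\<lambda>(x, y, z). (z, y)) \<in> \<theta> \<rightarrow>\<^sub>M (borel :: ('a \<times> 'b) measure)"
      unfolding measurable_cong_sets[OF sets refl] split_def
      by (intro borel_measurable_continuous_onI continuous_intros)+
    have f: "fst \<in> (borel :: ('a \<times> 'b) measure) \<rightarrow>\<^sub>M borel" "snd \<in> (borel :: ('a \<times> 'b) measure) \<rightarrow>\<^sub>M borel"
      by (simp_all flip: borel_prod)
    show "distr (distr \<theta> borel (\<lambda>(x, y, z). (x, y))) borel fst = distr \<theta> borel (\<lambda>(x, y, z). x)"
      "distr (distr \<theta> borel (\<lambda>(x, y, z). (x, y))) borel snd = distr \<theta> borel (\<lambda>(x, y, z). y)"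
      "distr (distr \<theta> borel (\<lambda>(x, y, z). (z, y))) borel fst = distr \<theta> borel (\<lambda>(x, y, z). z)"
      "distr (distr \<theta> borel (\<lambda>(x, y, z). (z, y))) borel snd = distr \<theta> borel (\<lambda>(x, y, z). y)"
      using distr_distr[OF f(1) m(1)] distr_distr[OF f(1) m(2)] distr_distr[OF f(2) m(1)] distr_distr[OF f(2) m(2)]
      by (simp_all add: comp_def split_def)
    show "distr \<theta> borel (\<lambda>(x, y, z). (z, y)) \<in> borel_probs"
      using \<theta> m(2) by (simp add: borel_probs_def prob_space.prob_space_distr)
  qed
  show ?thesis
  proof (intro iffI conjI ballI)
    assume \<pi>: "\<pi> \<in> total_C_superdiff a\<^sub>1 a\<^sub>2 c \<phi>"
    then show plan: "\<pi> \<in> plans_fin a\<^sub>1 a\<^sub>2" by (simp add: total_C_superdiff_def)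
    fix \<mu> \<pi>' assume \<mu>: "\<mu> \<in> probs_fin a\<^sub>1" and \<pi>': "\<pi>' \<in> couplings \<mu> (distr \<pi> borel snd)"
    have b: "\<pi> \<in> borel_probs" "\<pi>' \<in> borel_probs" "distr \<pi> borel snd = distr \<pi>' borel snd"
      using plan \<pi>' by (auto simp: plans_fin_def couplings_def)
    obtain \<theta> where \<theta>: "\<theta> \<in> borel_probs" "distr \<theta> borel (\<lambda>(x, y, z). (x, y)) = \<pi>" "distr \<theta> borel (\<lambda>(x, y, z). (z, y)) = \<pi>'"
      by (rule gluing[OF b])
    have marg: "distr \<theta> borel (\<lambda>(x, y, z). x) = distr \<pi> borel fst" "distr \<theta> borel (\<lambda>(x, y, z). z) = \<mu>"
      using proj[OF \<theta>(1)] \<theta> couplingsD(4)[OF \<pi>'] by simp_all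
    have fin: "(\<integral>\<^sup>+x. c x \<partial>\<pi>) < \<infinity>" "(\<integral>\<^sup>+x. c x \<partial>\<pi>') < \<infinity>"
      using cost_finite[OF _ _ plans_fin_couplings[OF plan]] cost_finite[OF \<mu> _ \<pi>'] plan
      by (auto simp: plans_fin_def)
    have "ereal (\<integral>(x, y, z). enn2real (c (x, y)) - enn2real (c (z, y)) \<partial>\<theta>) \<le> \<phi> (distr \<pi> borel fst) - \<phi> \<mu>"
      using \<pi> \<theta>(1,2) \<mu> unfolding total_C_superdiff_def by (auto simp flip: marg)
    then show "ereal (enn2real (\<integral>\<^sup>+x. c x \<partial>\<pi>) - enn2real (\<integral>\<^sup>+x. c x \<partial>\<pi>')) \<le> \<phi> (distr \<pi> borel fst) - \<phi> \<mu>"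
      using integral_cost_difference[OF c_measurable \<theta>(1,2) fin(1) \<theta>(3) fin(2)] by simp
  next
    assume *: "\<pi> \<in> plans_fin a\<^sub>1 a\<^sub>2 \<and> ?R"
    show "\<pi> \<in> total_C_superdiff a\<^sub>1 a\<^sub>2 c \<phi>"
      unfolding total_C_superdiff_def
    proof (intro CollectI conjI ballI impI)
      show plan: "\<pi> \<in> plans_fin a\<^sub>1 a\<^sub>2" using * by simp
      fix \<theta> :: "('a \<times> 'b \<times> 'a) measure"
      assume \<theta>: "\<theta> \<in> borel_probs" "distr \<theta> borel (\<lambda>(x, y, z). (x, y)) = \<pi>"
        and \<mu>: "distr \<theta> borel (\<lambda>(x, y, z). z) \<in> probs_fin a\<^sub>1"
      define \<pi>' where "\<pi>' = distr \<theta> borel (\<lambda>(x, y, z). (z, y))"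
      have \<pi>': "\<pi>' \<in> couplings (distr \<theta> borel (\<lambda>(x, y, z). z)) (distr \<pi> borel snd)"
        using proj[OF \<theta>(1)] zy[OF \<theta>(1)] by (simp add: couplings_def \<pi>'_def flip: \<theta>(2))
      have fst: "distr \<theta> borel (\<lambda>(x, y, z). x) = distr \<pi> borel fst"
        using proj[OF \<theta>(1)] \<theta>(2) by simp
      have fin: "(\<integral>\<^sup>+x. c x \<partial>\<pi>) < \<infinity>" "(\<integral>\<^sup>+x. c x \<partial>\<pi>') < \<infinity>"
        using cost_finite[OF _ _ plans_fin_couplings[OF plan]] cost_finite[OF \<mu> _ \<pi>'] plan
        by (auto simp: plans_fin_def)
      show "ereal (\<integral>(x, y, z). enn2real (c (x, y)) - enn2real (c (z, y)) \<partial>\<theta>)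
          \<le> \<phi> (distr \<theta> borel (\<lambda>(x, y, z). x)) - \<phi> (distr \<theta> borel (\<lambda>(x, y, z). z))"
        using integral_cost_difference[OF c_measurable \<theta> fin(1) \<pi>'_def[symmetric] fin(2)] * \<mu> \<pi>'
        by (simp add: fst)
    qed
  qed
qed

end

locale proper_potential = transport_cost a\<^sub>1 a\<^sub>2 c
  for a\<^sub>1 :: "'a::polish_space \<Rightarrow> ennreal" and a\<^sub>2 :: "'b::polish_space \<Rightarrow> ennreal" and c +
  fixes \<phi> :: "'a::polish_space measure \<Rightarrow> ereal"
  assumes less_top: "\<mu> \<in> probs_fin a\<^sub>1 \<Longrightarrow> \<phi> \<mu> < \<infinity>"
    and proper: "\<exists>\<mu>\<in>probs_fin a\<^sub>1. \<phi> \<mu> \<noteq> -\<infinity>"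
begin

lemma C_conj_less_top:
  assumes "\<nu> \<in> probs_fin a\<^sub>2"
  shows "C_conj a\<^sub>1 c \<phi> \<nu> < \<infinity>"
proof -
  obtain \<mu> where \<mu>: "\<mu> \<in> probs_fin a\<^sub>1" "\<phi> \<mu> \<noteq> -\<infinity>" using proper by blast
  obtain r where r: "OT_cost c \<mu> \<nu> = ennreal r" "0 \<le> r" using OT_cost_real[OF \<mu>(1) assms] .
  have "C_conj a\<^sub>1 c \<phi> \<nu> \<le> enn2ereal (OT_cost c \<mu> \<nu>) - \<phi> \<mu>"
    unfolding C_conj_def by (rule INF_lower) fact
  also have "\<dots> < \<infinity>" using \<mu> less_top[OF \<mu>(1)] r by (cases "\<phi> \<mu>") auto
  finally show ?thesis .
qed

lemma add_C_conj_le: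
  assumes \<mu>: "\<mu> \<in> probs_fin a\<^sub>1" and \<nu>: "\<nu> \<in> probs_fin a\<^sub>2"
  shows "\<phi> \<mu> + C_conj a\<^sub>1 c \<phi> \<nu> \<le> enn2ereal (OT_cost c \<mu> \<nu>)"
proof -
  obtain r where r: "OT_cost c \<mu> \<nu> = ennreal r" "0 \<le> r" using OT_cost_real[OF assms] .
  have "C_conj a\<^sub>1 c \<phi> \<nu> \<le> enn2ereal (OT_cost c \<mu> \<nu>) - \<phi> \<mu>"
    unfolding C_conj_def by (rule INF_lower) fact
  then show ?thesis
    using less_top[OF \<mu>] C_conj_less_top[OF \<nu>] r by (cases "\<phi> \<mu>"; cases "C_conj a\<^sub>1 c \<phi> \<nu>") auto
qed

lemma C_superdiff_iff:
  assumes \<mu>: "\<mu> \<in> probs_fin a\<^sub>1" and \<nu>: "\<nu> \<in> probs_fin a\<^sub>2"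
  shows "(\<mu>, \<nu>) \<in> C_superdiff a\<^sub>1 a\<^sub>2 c \<phi> \<longleftrightarrow> \<phi> \<mu> + C_conj a\<^sub>1 c \<phi> \<nu> = enn2ereal (OT_cost c \<mu> \<nu>)"
proof -
  obtain r where r: "OT_cost c \<mu> \<nu> = ennreal r" "0 \<le> r" using OT_cost_real[OF assms] .
  have "(\<mu>, \<nu>) \<in> C_superdiff a\<^sub>1 a\<^sub>2 c \<phi> \<longleftrightarrow> \<phi> \<mu> > -\<infinity> \<and> enn2ereal (OT_cost c \<mu> \<nu>) - \<phi> \<mu> \<le> C_conj a\<^sub>1 c \<phi> \<nu>"
    using assms by (simp add: C_superdiff_def C_conj_def le_INF_iff)
  also have "\<dots> \<longleftrightarrow> \<phi> \<mu> + C_conj a\<^sub>1 c \<phi> \<nu> = enn2ereal (OT_cost c \<mu> \<nu>)"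
    using add_C_conj_le[OF assms] less_top[OF \<mu>] C_conj_less_top[OF \<nu>] r
    by (cases "\<phi> \<mu>"; cases "C_conj a\<^sub>1 c \<phi> \<nu>") auto
  finally show ?thesis .
qed

lemma total_C_superdiff_iff:
  "\<pi> \<in> total_C_superdiff a\<^sub>1 a\<^sub>2 c \<phi> \<longleftrightarrow> \<pi> \<in> plans_fin a\<^sub>1 a\<^sub>2 \<and>
     \<phi> (distr \<pi> borel fst) + C_conj a\<^sub>1 c \<phi> (distr \<pi> borel snd) = enn2ereal (\<integral>\<^sup>+x. c x \<partial>\<pi>)"
proof (cases "\<pi> \<in> plans_fin a\<^sub>1 a\<^sub>2")
  case True
  define \<mu> where "\<mu> = distr \<pi> borel fst"
  define \<nu> where "\<nu> = distr \<pi> borel snd"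
  have \<mu>: "\<mu> \<in> probs_fin a\<^sub>1" and \<nu>: "\<nu> \<in> probs_fin a\<^sub>2" and \<pi>: "\<pi> \<in> couplings \<mu> \<nu>"
    using True plans_fin_couplings[OF True] by (auto simp: plans_fin_def \<mu>_def \<nu>_def)
  obtain s where s: "(\<integral>\<^sup>+x. c x \<partial>\<pi>) = ennreal s" "0 \<le> s"
    using cost_finite[OF \<mu> \<nu> \<pi>] by (cases "\<integral>\<^sup>+x. c x \<partial>\<pi>") auto
  have "(\<forall>\<mu>'\<in>probs_fin a\<^sub>1. \<forall>\<pi>'\<in>couplings \<mu>' \<nu>. ereal (s - enn2real (\<integral>\<^sup>+x. c x \<partial>\<pi>')) \<le> \<phi> \<mu> - \<phi> \<mu>') \<longleftrightarrow>
      \<phi> \<mu> + C_conj a\<^sub>1 c \<phi> \<nu> = ereal s" (is "?L \<longleftrightarrow> ?R")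
  proof
    assume L: ?L
    obtain \<mu>\<^sub>0 where \<mu>\<^sub>0: "\<mu>\<^sub>0 \<in> probs_fin a\<^sub>1" "\<phi> \<mu>\<^sub>0 \<noteq> -\<infinity>" using proper by blast
    have "\<mu>\<^sub>0 \<Otimes>\<^sub>M \<nu> \<in> couplings \<mu>\<^sub>0 \<nu>"
      by (rule couplings_nonempty) (use \<mu>\<^sub>0 \<nu> in \<open>auto simp: probs_fin_def\<close>)
    with L \<mu>\<^sub>0(1) have "ereal (s - enn2real (\<integral>\<^sup>+x. c x \<partial>(\<mu>\<^sub>0 \<Otimes>\<^sub>M \<nu>))) \<le> \<phi> \<mu> - \<phi> \<mu>\<^sub>0" by blast
    then obtain p where p: "\<phi> \<mu> = ereal p"
      using \<mu>\<^sub>0(2) less_top[OF \<mu>\<^sub>0(1)] less_top[OF \<mu>] by (cases "\<phi> \<mu>"; cases "\<phi> \<mu>\<^sub>0") auto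
    have "ereal (s - p) \<le> C_conj a\<^sub>1 c \<phi> \<nu>"
      unfolding C_conj_def
    proof (rule INF_greatest)
      fix \<mu>' assume \<mu>': "\<mu>' \<in> probs_fin a\<^sub>1"
      obtain \<pi>' where \<pi>': "\<pi>' \<in> opt_couplings c \<mu>' \<nu>" using opt_coupling_exists[OF \<mu>' \<nu>] .
      obtain r where r: "OT_cost c \<mu>' \<nu> = ennreal r" "0 \<le> r" using OT_cost_real[OF \<mu>' \<nu>] .
      from \<pi>' have "\<pi>' \<in> couplings \<mu>' \<nu>" "(\<integral>\<^sup>+x. c x \<partial>\<pi>') = ennreal r"
        by (simp_all add: opt_couplings_iff r)
      with L \<mu>' r have "ereal (s - r) \<le> \<phi> \<mu> - \<phi> \<mu>'" by (metis enn2real_ennreal)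
      then show "ereal (s - p) \<le> enn2ereal (OT_cost c \<mu>' \<nu>) - \<phi> \<mu>'"
        using less_top[OF \<mu>'] r p by (cases "\<phi> \<mu>'") auto
    qed
    then have "ereal s \<le> \<phi> \<mu> + C_conj a\<^sub>1 c \<phi> \<nu>"
      using p by (cases "C_conj a\<^sub>1 c \<phi> \<nu>") auto
    moreover have "enn2ereal (OT_cost c \<mu> \<nu>) \<le> ereal s"
      using OT_cost_le[OF \<pi>, of c] s by (metis enn2ereal_ennreal less_eq_ennreal.rep_eq)
    ultimately show ?R using add_C_conj_le[OF \<mu> \<nu>] by (metis order_antisym order_trans)
  next
    assume R: ?R
    show ?L
    proof (intro ballI)
      fix \<mu>' \<pi>' assume \<mu>': "\<mu>' \<in> probs_fin a\<^sub>1" and \<pi>': "\<pi>' \<in> couplings \<mu>' \<nu>"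
      obtain t where t: "(\<integral>\<^sup>+x. c x \<partial>\<pi>') = ennreal t" "0 \<le> t"
        using cost_finite[OF \<mu>' \<nu> \<pi>'] by (cases "\<integral>\<^sup>+x. c x \<partial>\<pi>'") auto
      have "enn2ereal (OT_cost c \<mu>' \<nu>) \<le> ereal t"
        using OT_cost_le[OF \<pi>', of c] t by (metis enn2ereal_ennreal less_eq_ennreal.rep_eq)
      with add_C_conj_le[OF \<mu>' \<nu>] have "\<phi> \<mu>' + C_conj a\<^sub>1 c \<phi> \<nu> \<le> ereal t" by (rule order_trans)
      then show "ereal (s - enn2real (\<integral>\<^sup>+x. c x \<partial>\<pi>')) \<le> \<phi> \<mu> - \<phi> \<mu>'"
        using R t less_top[OF \<mu>'] by (cases "\<phi> \<mu>"; cases "C_conj a\<^sub>1 c \<phi> \<nu>"; cases "\<phi> \<mu>'") auto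
    qed
  qed
  then show ?thesis
    using True s by (simp add: total_C_superdiff_iff_couplings enn2ereal_ennreal flip: \<mu>_def \<nu>_def)
qed (simp add: total_C_superdiff_def)

lemma total_C_superdiff_iff_opt:
  "\<pi> \<in> total_C_superdiff a\<^sub>1 a\<^sub>2 c \<phi> \<longleftrightarrow> \<pi> \<in> plans_fin a\<^sub>1 a\<^sub>2 \<and>
     \<pi> \<in> opt_couplings c (distr \<pi> borel fst) (distr \<pi> borel snd) \<and>
     (distr \<pi> borel fst, distr \<pi> borel snd) \<in> C_superdiff a\<^sub>1 a\<^sub>2 c \<phi>"
proof (cases "\<pi> \<in> plans_fin a\<^sub>1 a\<^sub>2")
  case True
  define \<mu> where "\<mu> = distr \<pi> borel fst"
  define \<nu> where "\<nu> = distr \<pi> borel snd"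
  have \<mu>: "\<mu> \<in> probs_fin a\<^sub>1" and \<nu>: "\<nu> \<in> probs_fin a\<^sub>2" and \<pi>: "\<pi> \<in> couplings \<mu> \<nu>"
    using True plans_fin_couplings[OF True] by (auto simp: plans_fin_def \<mu>_def \<nu>_def)
  have "enn2ereal (OT_cost c \<mu> \<nu>) \<le> enn2ereal (\<integral>\<^sup>+x. c x \<partial>\<pi>)"
    using OT_cost_le[OF \<pi>, of c] by (simp add: less_eq_ennreal.rep_eq)
  with add_C_conj_le[OF \<mu> \<nu>] show ?thesis
    using True \<pi> unfolding total_C_superdiff_iff opt_couplings_iff
    by (auto simp: C_superdiff_iff[OF \<mu> \<nu>] enn2ereal_inject simp flip: \<mu>_def \<nu>_def)
qed (simp add: total_C_superdiff_def)

lemma image_total_C_superdiff: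
  "(\<lambda>\<pi>. (distr \<pi> borel fst, distr \<pi> borel snd)) ` total_C_superdiff a\<^sub>1 a\<^sub>2 c \<phi> = C_superdiff a\<^sub>1 a\<^sub>2 c \<phi>"
proof
  show "C_superdiff a\<^sub>1 a\<^sub>2 c \<phi> \<subseteq> (\<lambda>\<pi>. (distr \<pi> borel fst, distr \<pi> borel snd)) ` total_C_superdiff a\<^sub>1 a\<^sub>2 c \<phi>"
  proof
    fix p assume p: "p \<in> C_superdiff a\<^sub>1 a\<^sub>2 c \<phi>"
    then have "fst p \<in> probs_fin a\<^sub>1" "snd p \<in> probs_fin a\<^sub>2" by (auto simp: C_superdiff_def)
    then obtain \<pi> where \<pi>: "\<pi> \<in> opt_couplings c (fst p) (snd p)" "\<pi> \<in> plans_fin a\<^sub>1 a\<^sub>2"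
      by (rule opt_coupling_exists)
    then have "distr \<pi> borel fst = fst p" "distr \<pi> borel snd = snd p"
      by (auto simp: opt_couplings_def couplings_def)
    with \<pi> p show "p \<in> (\<lambda>\<pi>. (distr \<pi> borel fst, distr \<pi> borel snd)) ` total_C_superdiff a\<^sub>1 a\<^sub>2 c \<phi>"
      by (intro image_eqI[of _ _ \<pi>]) (simp_all add: total_C_superdiff_iff_opt)
  qed
qed (auto simp: total_C_superdiff_iff_opt)

lemma totally_C_cyclically_monotone_total_C_superdiff:
  "totally_C_cyclically_monotone c (total_C_superdiff a\<^sub>1 a\<^sub>2 c \<phi>)"
  unfolding totally_C_cyclically_monotone_def
proof (intro allI impI)
  fix N :: nat and \<theta> :: "(nat \<Rightarrow> 'a \<times> 'b) measure" and \<sigma>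
  assume "prob_space \<theta>" and sets: "sets \<theta> = sets (\<Pi>\<^sub>M n\<in>{1..N}. borel)"
    and marg: "\<forall>n\<in>{1..N}. distr \<theta> borel (\<lambda>x. x n) \<in> total_C_superdiff a\<^sub>1 a\<^sub>2 c \<phi>"
    and \<sigma>: "\<sigma> permutes {1..N}"
  interpret prob_space \<theta> by fact
  define \<mu> where "\<mu> i = distr (distr \<theta> borel (\<lambda>x. x i)) borel fst" for i
  define \<nu> where "\<nu> i = distr (distr \<theta> borel (\<lambda>x. x i)) borel snd" for i
  have comp[measurable]: "(\<lambda>x. x i) \<in> \<theta> \<rightarrow>\<^sub>M borel" if "i \<in> {1..N}" for i
    using measurable_component_singleton[OF that, of "\<lambda>_. borel"] by (simp cong: measurable_cong_sets add: sets)
  have f: "fst \<in> (borel :: ('a \<times> 'b) measure) \<rightarrow>\<^sub>M borel" "snd \<in> (borel :: ('a \<times> 'b) measure) \<rightarrow>\<^sub>M borel"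
    by (simp_all flip: borel_prod)
  have pair: "(\<lambda>x. (fst (x i), snd (x j))) \<in> \<theta> \<rightarrow>\<^sub>M borel" if "i \<in> {1..N}" "j \<in> {1..N}" for i j
    using measurable_Pair[OF measurable_compose[OF comp[OF that(1)] f(1)] measurable_compose[OF comp[OF that(2)] f(2)]]
    by (simp add: borel_prod)
  define I where "I i j = (\<integral>\<^sup>+x. c (fst (x i), snd (x j)) \<partial>\<theta>)" for i j
  have I: "I i j = (\<integral>\<^sup>+x. c x \<partial>distr \<theta> borel (\<lambda>x. (fst (x i), snd (x j))))" if "i \<in> {1..N}" "j \<in> {1..N}" for i j
    unfolding I_def by (rule nn_integral_distr[symmetric]) (use pair[OF that] c_measurable in auto)
  have coupling: "distr \<theta> borel (\<lambda>x. (fst (x i), snd (x j))) \<in> couplings (\<mu> i) (\<nu> j)"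
    if "i \<in> {1..N}" "j \<in> {1..N}" for i j
    using pair[OF that] comp[OF that(1)] comp[OF that(2)]
    by (simp add: couplings_def borel_probs_def prob_space_distr distr_distr f \<mu>_def \<nu>_def comp_def)
  have diag: "distr \<theta> borel (\<lambda>x. (fst (x i), snd (x i))) = distr \<theta> borel (\<lambda>x. x i)" for i by simp
  have fin: "\<mu> i \<in> probs_fin a\<^sub>1" "\<nu> i \<in> probs_fin a\<^sub>2" if "i \<in> {1..N}" for i
    using marg that by (auto simp: total_C_superdiff_def plans_fin_def \<mu>_def \<nu>_def)
  define p where "p i = real_of_ereal (\<phi> (\<mu> i))" for i
  define q where "q i = real_of_ereal (C_conj a\<^sub>1 c \<phi> (\<nu> i))" for i
  have pq: "\<phi> (\<mu> i) = ereal (p i) \<and> C_conj a\<^sub>1 c \<phi> (\<nu> i) = ereal (q i) \<and> 0 \<le> p i + q i \<and> I i i = ennreal (p i + q i)"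
    if i: "i \<in> {1..N}" for i
  proof -
    have eq: "\<phi> (\<mu> i) + C_conj a\<^sub>1 c \<phi> (\<nu> i) = enn2ereal (I i i)"
      using marg i by (simp add: total_C_superdiff_iff I[OF i i] \<mu>_def \<nu>_def)
    obtain r where r: "I i i = ennreal r" "0 \<le> r"
      using cost_finite[OF fin[OF i] coupling[OF i i]] by (cases "I i i") (auto simp: I[OF i i])
    show ?thesis
      using eq r by (cases "\<phi> (\<mu> i)"; cases "C_conj a\<^sub>1 c \<phi> (\<nu> i)") (auto simp: p_def q_def)
  qed
  have le: "ennreal (p i + q j) \<le> I i j" if ij: "i \<in> {1..N}" "j \<in> {1..N}" for i j
  proof -
    have "ereal (p i + q j) \<le> enn2ereal (OT_cost c (\<mu> i) (\<nu> j))"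
      using add_C_conj_le[OF fin(1)[OF ij(1)] fin(2)[OF ij(2)]] pq[OF ij(1)] pq[OF ij(2)] by simp
    then have "ennreal (p i + q j) \<le> OT_cost c (\<mu> i) (\<nu> j)"
      by (metis e2ennreal_enn2ereal e2ennreal_ereal e2ennreal_mono)
    also have "\<dots> \<le> I i j" unfolding I[OF ij] by (rule OT_cost_le[OF coupling[OF ij]])
    finally show ?thesis .
  qed
  have \<sigma>_in: "\<sigma> i \<in> {1..N}" if "i \<in> {1..N}" for i using permutes_in_image[OF \<sigma>] that by blast
  have c_pair: "(\<lambda>x. c (fst (x i), snd (x j))) \<in> borel_measurable \<theta>" if "i \<in> {1..N}" "j \<in> {1..N}" for i j
    by (rule measurable_compose[OF pair[OF that] c_measurable])
  have "(\<integral>\<^sup>+x. (\<Sum>i=1..N. c (fst (x i), snd (x i))) \<partial>\<theta>) = (\<Sum>i=1..N. I i i)"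
    unfolding I_def by (rule nn_integral_sum) (rule c_pair)
  also have "\<dots> = (\<Sum>i=1..N. ennreal (p i + q i))" by (rule sum.cong) (use pq in auto)
  also have "\<dots> = ennreal (\<Sum>i=1..N. p i + q i)" by (rule sum_ennreal) (use pq in auto)
  also have "(\<Sum>i=1..N. p i + q i) = (\<Sum>i=1..N. p i + q (\<sigma> i))"
    using sum.permute[OF \<sigma>, of q] by (simp add: sum.distrib comp_def)
  also have "ennreal \<dots> \<le> ennreal (\<Sum>i=1..N. max 0 (p i + q (\<sigma> i)))"
    by (intro ennreal_leI sum_mono) simp
  also have "\<dots> = (\<Sum>i=1..N. ennreal (p i + q (\<sigma> i)))"
    by (simp add: ennreal_max_0 flip: sum_ennreal)
  also have "\<dots> \<le> (\<Sum>i=1..N. I i (\<sigma> i))"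
    by (rule sum_mono) (rule le[OF _ \<sigma>_in])
  also have "\<dots> = (\<integral>\<^sup>+x. (\<Sum>i=1..N. c (fst (x i), snd (x (\<sigma> i)))) \<partial>\<theta>)"
    unfolding I_def by (rule nn_integral_sum[symmetric]) (rule c_pair[OF _ \<sigma>_in])
  finally show "(\<integral>\<^sup>+x. (\<Sum>i=1..N. c (fst (x i), snd (x i))) \<partial>\<theta>)
      \<le> (\<integral>\<^sup>+x. (\<Sum>i=1..N. c (fst (x i), snd (x (\<sigma> i)))) \<partial>\<theta>)" .
qed

end

theorem proposition3p7:
  fixes a\<^sub>1 :: "'a::polish_space \<Rightarrow> ennreal"
    and a\<^sub>2 :: "'b::polish_space \<Rightarrow> ennreal"
    and c :: "'a \<times> 'b \<Rightarrow> ennreal"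
    and \<phi>\<^sub>1 :: "'a measure \<Rightarrow> ereal"
  assumes "a\<^sub>1 \<in> borel_measurable borel"
    and "a\<^sub>2 \<in> borel_measurable borel"
    and "lower_semicont c"
    and "\<And>x\<^sub>1 x\<^sub>2. c (x\<^sub>1, x\<^sub>2) \<le> a\<^sub>1 x\<^sub>1 + a\<^sub>2 x\<^sub>2"
    and "\<And>\<mu>\<^sub>1. \<mu>\<^sub>1 \<in> probs_fin a\<^sub>1 \<Longrightarrow> \<phi>\<^sub>1 \<mu>\<^sub>1 < \<infinity>"
    and "C_concave a\<^sub>1 a\<^sub>2 c \<phi>\<^sub>1"
    and "\<exists>\<mu>\<^sub>1\<in>probs_fin a\<^sub>1. \<phi>\<^sub>1 \<mu>\<^sub>1 \<noteq> -\<infinity>"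
  shows
    "total_C_superdiff a\<^sub>1 a\<^sub>2 c \<phi>\<^sub>1 =
       {\<pi> \<in> plans_fin a\<^sub>1 a\<^sub>2.
          \<pi> \<in> opt_couplings c (distr \<pi> borel fst) (distr \<pi> borel snd) \<and>
          (distr \<pi> borel fst, distr \<pi> borel snd) \<in> C_superdiff a\<^sub>1 a\<^sub>2 c \<phi>\<^sub>1} \<and>
     (\<forall>\<pi>\<in>total_C_superdiff a\<^sub>1 a\<^sub>2 c \<phi>\<^sub>1.
        \<pi> \<in> opt_couplings c (distr \<pi> borel fst) (distr \<pi> borel snd)) \<and>
     (\<lambda>\<pi>. (distr \<pi> borel fst, distr \<pi> borel snd)) ` total_C_superdiff a\<^sub>1 a\<^sub>2 c \<phi>\<^sub>1 =
       C_superdiff a\<^sub>1 a\<^sub>2 c \<phi>\<^sub>1 \<and>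
     (\<forall>\<pi>\<in>plans_fin a\<^sub>1 a\<^sub>2. \<pi> \<in> total_C_superdiff a\<^sub>1 a\<^sub>2 c \<phi>\<^sub>1 \<longleftrightarrow>
        \<phi>\<^sub>1 (distr \<pi> borel fst) + C_conj a\<^sub>1 c \<phi>\<^sub>1 (distr \<pi> borel snd) =
          enn2ereal (\<integral>\<^sup>+(x\<^sub>1, x\<^sub>2). c (x\<^sub>1, x\<^sub>2) \<partial>\<pi>)) \<and>
     totally_C_cyclically_monotone c (total_C_superdiff a\<^sub>1 a\<^sub>2 c \<phi>\<^sub>1)"
proof -
  interpret proper_potential a\<^sub>1 a\<^sub>2 c \<phi>\<^sub>1
    by unfold_locales (use assms in auto)
  have cost: "(\<integral>\<^sup>+(x\<^sub>1, x\<^sub>2). c (x\<^sub>1, x\<^sub>2) \<partial>\<pi>) = (\<integral>\<^sup>+x. c x \<partial>\<pi>)" for \<pi>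
    by (simp add: split_def)
  have iff: "total_C_superdiff a\<^sub>1 a\<^sub>2 c \<phi>\<^sub>1 =
       {\<pi> \<in> plans_fin a\<^sub>1 a\<^sub>2.
          \<pi> \<in> opt_couplings c (distr \<pi> borel fst) (distr \<pi> borel snd) \<and>
          (distr \<pi> borel fst, distr \<pi> borel snd) \<in> C_superdiff a\<^sub>1 a\<^sub>2 c \<phi>\<^sub>1}"
    using total_C_superdiff_iff_opt by blast
  moreover have "\<forall>\<pi>\<in>total_C_superdiff a\<^sub>1 a\<^sub>2 c \<phi>\<^sub>1.
      \<pi> \<in> opt_couplings c (distr \<pi> borel fst) (distr \<pi> borel snd)"
    by (simp add: iff)
  moreover have "\<forall>\<pi>\<in>plans_fin a\<^sub>1 a\<^sub>2. \<pi> \<in> total_C_superdiff a\<^sub>1 a\<^sub>2 c \<phi>\<^sub>1 \<longleftrightarrow>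
      \<phi>\<^sub>1 (distr \<pi> borel fst) + C_conj a\<^sub>1 c \<phi>\<^sub>1 (distr \<pi> borel snd) =
        enn2ereal (\<integral>\<^sup>+(x\<^sub>1, x\<^sub>2). c (x\<^sub>1, x\<^sub>2) \<partial>\<pi>)"
    by (simp add: total_C_superdiff_iff cost)
  ultimately show ?thesis
    using image_total_C_superdiff totally_C_cyclically_monotone_total_C_superdiff by (intro conjI)
qed

end
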